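(* Let $\mathbb{X}=\{X(t)\}_{t\ge0}$ be a random cubical filtration in $\mathbb{R}^d$ that is stationary and $R$-dependent for some integer $R\ge 0$. Fix an integer $0\le q<d$ and real numbers $0\le s\le t<\infty$. Then there exists a constant $\widehat\beta_q(s,t)\in[0,\infty)$ such that \[ \frac{\mathbb{E}[\beta_q^{\mathbb{X}^n}(s,t)]}{|\Lambda^n|}\to\widehat\beta_q(s,t)\quad\text{and}\quad \frac{\beta_q^{\mathbb{X}^n}(s,t)}{|\Lambda^n|}\to\widehat\beta_q(s,t)\ \text{almost surely, as } n\to\infty. \]
   Context: Fix $d\in\mathbb{N}$. An elementary interval is $[l,l+1]$ or $\{l\}$ with $l\in\mathbb{Z}$; an elementary cube in $\mathbb{R}^d$ is a product $I_1\times\cdots\times I_d$ of elementary intervals, and its dimension is the number of nondegenerate factors $[l,l+1]$. $\mathcal{K}^d$ is the set of all elementary cubes and $\mathcal{K}^d_q$ those of dimension $q$; for a cubical set $X$, $\mathcal{K}^d_q(X)$ is the set of elementary $q$-cubes contained in $X$. A cubical set is a (possibly infinite) union of elementary cubes; it is bounded if it is a finite union. Homology $H_q(X)$ is cubical homology with real coefficients (chain groups spanned by elementary $q$-cubes in $X$, with the standard cubical boundary). A cubical filtration is an increasing family $\{X(t)\}_{t\ge0}$ of cubical sets with $X(t)=\bigcap_{t'>t}X(t')$; it is bounded if $\bigcup_t X(t)$ is bounded. For a bounded cubical filtration $\mathbb{X}$, $0\le q$ and $0\le s\le t<\infty$, the persistent Betti number $\beta_q^{\mathbb{X}}(s,t)$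 is the rank of the map $H_q(X(s))\to H_q(X(t))$ induced by inclusion. The birth time of $Q\in\mathcal{K}^d$ in $\mathbb{X}$ is $t^{\mathbb{X}}_Q=\inf\{t\ge0: Q\subset X(t)\}$ ($=\infty$ if never). A random cubical filtration is a random variable in the set of cubical filtrations equipped with the $\sigma$-field generated by the maps $\mathbb{X}\mapsto t^{\mathbb{X}}_Q$, $Q\in\mathcal{K}^d$. It is stationary if for every $z\in\mathbb{Z}^d$ the families $\{t^{\mathbb{X}}_Q\}_{Q\in\mathcal{K}^d}$ and $\{t^{\mathbb{X}}_{z+Q}\}_{Q\in\mathcal{K}^d}$ have the same law; it is $R$-dependent if for all $A,B\subset\mathbb{R}^d$ with $\inf\{\|x-y\|_{\max}:x\in A,y\in B\}>R$ the families $\{t^{\mathbb{X}}_Q: Q\subset A\}$ and $\{t^{\mathbb{X}}_Q:Q\subset B\}$ are independent. $\Lambda^n=[-n,n]^d$, $|\Lambda^n|=(2n)^d$ its Lebesgue measure, and $\mathbb{X}^n=\{X(t)\cap\Lambda^n\}_{t\ge0}$. *)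

theory Defs
  imports "HOL-Probability.Probability" "HOL-Library.Function_Algebras"
begin

text \<open>Ambient space R^d: points are functions nat => real vanishing on coordinates >= d.
  An elementary interval is encoded as (l, True) for [l,l+1] and (l, False) for {l}.
  An elementary cube in R^d is a map nat => int x bool with value (0,False) for i >= d.\<close>

type_synonym point = "nat \<Rightarrow> real"
type_synonym ecube = "nat \<Rightarrow> int \<times> bool"

definition Rd :: "nat \<Rightarrow> point set" where
  "Rd d = {x. \<forall>i\<ge>d. x i = 0}"

definition Kube :: "nat \<Rightarrow> ecube set" where
  "Kube d = {Q. \<forall>i\<ge>d. Q i = (0, False)}"

definition ival :: "int \<times> bool \<Rightarrow> real set" where
  "ival I = (if snd I then {real_of_int (fst I) .. real_of_int (fst I) + 1}
             else {real_of_int (fst I)})"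

definition cell :: "nat \<Rightarrow> ecube \<Rightarrow> point set" where
  "cell d Q = {x \<in> Rd d. \<forall>i<d. x i \<in> ival (Q i)}"

definition cdim :: "nat \<Rightarrow> ecube \<Rightarrow> nat" where
  "cdim d Q = card {i. i < d \<and> snd (Q i)}"

definition cubical :: "nat \<Rightarrow> point set \<Rightarrow> bool" where
  "cubical d X \<longleftrightarrow> (\<exists>F \<subseteq> Kube d. X = \<Union> (cell d ` F))"

definition cubes_of :: "nat \<Rightarrow> nat \<Rightarrow> point set \<Rightarrow> ecube set" where
  "cubes_of d q X = {Q \<in> Kube d. cdim d Q = q \<and> cell d Q \<subseteq> X}"

type_synonym chain = "ecube \<Rightarrow> real"

definition chains :: "nat \<Rightarrow> nat \<Rightarrow> point set \<Rightarrow> chain set" where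
  "chains d q X = {c. finite {Q. c Q \<noteq> 0} \<and> (\<forall>Q. c Q \<noteq> 0 \<longrightarrow> Q \<in> cubes_of d q X)}"

text \<open>Incidence coefficient of the standard cubical boundary:
  boundary of Q = sum over nondegenerate coordinates i of
  (-1)^(number of nondegenerate j < i) * (Q with [l_i+1] at i  -  Q with [l_i] at i).\<close>
definition incid :: "nat \<Rightarrow> ecube \<Rightarrow> ecube \<Rightarrow> real" where
  "incid d Q P = (\<Sum>i\<in>{i. i < d \<and> snd (Q i)}.
      (-1) ^ card {j. j < i \<and> snd (Q j)} *
      ((if P = Q(i := (fst (Q i) + 1, False)) then 1 else 0)
       - (if P = Q(i := (fst (Q i), False)) then 1 else 0)))"

definition bdry :: "nat \<Rightarrow> chain \<Rightarrow> chain" where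
  "bdry d c = (\<lambda>P. \<Sum>Q\<in>{Q. c Q \<noteq> 0}. c Q * incid d Q P)"

definition cycles :: "nat \<Rightarrow> nat \<Rightarrow> point set \<Rightarrow> chain set" where
  "cycles d q X = {c \<in> chains d q X. bdry d c = (\<lambda>_. 0)}"

definition boundaries :: "nat \<Rightarrow> nat \<Rightarrow> point set \<Rightarrow> chain set" where
  "boundaries d q X = bdry d ` chains d (Suc q) X"

definition chain_dim :: "chain set \<Rightarrow> nat" where
  "chain_dim V = vector_space.dim (\<lambda>(r::real) (c::chain) Q. r * c Q) V"

text \<open>Rank of H_q(Xs) -> H_q(Xt) induced by inclusion Xs \<subseteq> Xt (real coefficients):
  the image of H_q(Xs) = Z_q(Xs)/B_q(Xs) in H_q(Xt) = Z_q(Xt)/B_q(Xt) is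
  Z_q(Xs)/(Z_q(Xs) \<inter> B_q(Xt)).\<close>
definition pers_betti :: "nat \<Rightarrow> nat \<Rightarrow> point set \<Rightarrow> point set \<Rightarrow> nat" where
  "pers_betti d q Xs Xt =
     chain_dim (cycles d q Xs) - chain_dim (cycles d q Xs \<inter> boundaries d q Xt)"

definition cubical_filtration :: "nat \<Rightarrow> (real \<Rightarrow> point set) \<Rightarrow> bool" where
  "cubical_filtration d X \<longleftrightarrow>
     (\<forall>t\<ge>0. cubical d (X t)) \<and>
     (\<forall>s t. 0 \<le> s \<longrightarrow> s \<le> t \<longrightarrow> X s \<subseteq> X t) \<and>
     (\<forall>t\<ge>0. X t = (\<Inter>t'\<in>{t<..}. X t'))"

definition birth :: "nat \<Rightarrow> (real \<Rightarrow> point set) \<Rightarrow> ecube \<Rightarrow> ereal" where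
  "birth d X Q = Inf {ereal t | t. 0 \<le> t \<and> cell d Q \<subseteq> X t}"

definition shift :: "nat \<Rightarrow> (nat \<Rightarrow> int) \<Rightarrow> ecube \<Rightarrow> ecube" where
  "shift d z Q = (\<lambda>i. if i < d then (z i + fst (Q i), snd (Q i)) else Q i)"

definition maxdist :: "nat \<Rightarrow> point \<Rightarrow> point \<Rightarrow> real" where
  "maxdist d x y = Max (insert 0 ((\<lambda>i. \<bar>x i - y i\<bar>) ` {..<d}))"

definition setdist_max :: "nat \<Rightarrow> point set \<Rightarrow> point set \<Rightarrow> ereal" where
  "setdist_max d A B = (INF x\<in>A. INF y\<in>B. ereal (maxdist d x y))"

definition Lam :: "nat \<Rightarrow> nat \<Rightarrow> point set" where
  "Lam d n = {x \<in> Rd d. \<forall>i<d. - real n \<le> x i \<and> x i \<le> real n}"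

definition births_on :: "nat \<Rightarrow> ('w \<Rightarrow> real \<Rightarrow> point set) \<Rightarrow> ecube set \<Rightarrow> 'w \<Rightarrow> ecube \<Rightarrow> ereal" where
  "births_on d X K = (\<lambda>\<omega>. \<lambda>Q\<in>K. birth d (X \<omega>) Q)"

definition random_cubical_filtration :: "nat \<Rightarrow> 'w measure \<Rightarrow> ('w \<Rightarrow> real \<Rightarrow> point set) \<Rightarrow> bool" where
  "random_cubical_filtration d M X \<longleftrightarrow>
     (\<forall>\<omega>\<in>space M. cubical_filtration d (X \<omega>)) \<and>
     (\<forall>Q\<in>Kube d. (\<lambda>\<omega>. birth d (X \<omega>) Q) \<in> borel_measurable M)"

definition stationary :: "nat \<Rightarrow> 'w measure \<Rightarrow> ('w \<Rightarrow> real \<Rightarrow> point set) \<Rightarrow> bool" where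
  "stationary d M X \<longleftrightarrow>
     (\<forall>z::nat \<Rightarrow> int.
        distr M (PiM (Kube d) (\<lambda>_. borel)) (births_on d X (Kube d)) =
        distr M (PiM (Kube d) (\<lambda>_. borel))
          (\<lambda>\<omega>. \<lambda>Q\<in>Kube d. birth d (X \<omega>) (shift d z Q)))"

definition R_dependent :: "nat \<Rightarrow> 'w measure \<Rightarrow> real \<Rightarrow> ('w \<Rightarrow> real \<Rightarrow> point set) \<Rightarrow> bool" where
  "R_dependent d M R X \<longleftrightarrow>
     (\<forall>A B. A \<subseteq> Rd d \<longrightarrow> B \<subseteq> Rd d \<longrightarrow> setdist_max d A B > ereal R \<longrightarrow>
        (let KA = {Q \<in> Kube d. cell d Q \<subseteq> A}; KB = {Q \<in> Kube d. cell d Q \<subseteq> B} in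
         prob_space.indep_var M
           (PiM KA (\<lambda>_. borel)) (births_on d X KA)
           (PiM KB (\<lambda>_. borel)) (births_on d X KB)))"

end

theory Submission
  imports Defs "HOL-Real_Asymp.Real_Asymp"
begin

text \<open>
  The persistent Betti number depends only on the finite sets of \<open>q\<close>-cubes alive at time \<open>s\<close> and
  of \<open>(q+1)\<close>-cubes alive at time \<open>t\<close>; adding one cube changes it by a bounded amount, and it is
  additive over sets of cubes that are closed under faces and pairwise disjoint. Cut the window
  into blocks of side \<open>k\<close> separated by corridors of width \<open>R + 1\<close>. Discarding the cubes outside the
  blocks costs a fraction of the volume that vanishes as \<open>k\<close> grows, uniformly in the window.
  The block contributions are bounded, identically distributed and pairwise independent, so the mean
  densities form a Cauchy sequence, and a variance bound gives almost sure convergence along the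
  windows of size \<open>j\<^sup>2\<close>; the Lipschitz property fills the gaps between consecutive squares.
\<close>

section \<open>Finite-dimensional spaces of chains\<close>

text \<open>Adding cubes can raise or lower a persistent Betti number, so the window values are in
  general neither monotone nor subadditive, and additivity over separated blocks up to a counted
  error takes the place of a subadditive limit theorem. The error is counted in cubes. A box of side
  k contains (2k+1)^d of them, about 2^d per unit volume for large boxes, while the blocks
  contribute (2k+1)^d per lattice cell of side k+R+1. Both densities tend to 2^d, so their
  difference vanishes as k grows. The dependence hypothesis concerns two regions at a time, which is
  what a second-moment bound asks for. That bound makes the variance of the density of order n^(-d),
  which is not summable over n when d = 1; along n = j^2 it is at most a constant times j^(-2) for
  every d >= 1. The side k stays fixed while n grows and is chosen only in terms of the desired
  precision, so no limit in k has to be identified.\<close>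

interpretation fun_vs: vector_space "\<lambda>(r::real) (c::'a \<Rightarrow> real) x. r * c x"
  by unfold_locales (auto simp: fun_eq_iff algebra_simps)

text \<open>No finiteness of the support is demanded, so conditions on supports stay purely
  pointwise. For finite \<open>S\<close> this is the usual chain group.\<close>

definition chains_on :: "'a set \<Rightarrow> ('a \<Rightarrow> real) set" where
  "chains_on S = {c. \<forall>x. c x \<noteq> 0 \<longrightarrow> x \<in> S}"

lemma chains_on_mono: "S \<subseteq> T \<Longrightarrow> chains_on S \<subseteq> chains_on T"
  by (auto simp: chains_on_def)

lemma subspace_chains_on: "fun_vs.subspace (chains_on S)"
  unfolding fun_vs.subspace_def by (auto simp: chains_on_def) (metis add.right_neutral)

lemma sum_fun_apply: "(\<Sum>i\<in>I. f i) x = (\<Sum>i\<in>I. f i x :: real)"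
  by (induction I rule: infinite_finite_induct) auto

lemma chains_on_subset_span:
  assumes "finite K"
  shows "chains_on K \<subseteq> fun_vs.span ((\<lambda>y x. if x = y then 1 else 0) ` K)"
proof
  fix c assume c: "c \<in> chains_on K"
  have "c = (\<Sum>y\<in>K. (\<lambda>x. c y * (if x = y then 1 else 0)))"
  proof
    fix x
    have "(\<Sum>y\<in>K. (\<lambda>x. c y * (if x = y then 1 else 0))) x = (\<Sum>y\<in>K. if y = x then c x else 0)"
      unfolding sum_fun_apply by (intro sum.cong) auto
    also have "\<dots> = c x"
      using assms c by (auto simp: chains_on_def sum.delta)
    finally show "c x = (\<Sum>y\<in>K. (\<lambda>x. c y * (if x = y then 1 else 0))) x" ..
  qed
  also have "\<dots> \<in> fun_vs.span ((\<lambda>y x. if x = y then 1 else 0) ` K)"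
    by (intro fun_vs.span_sum fun_vs.span_scale fun_vs.span_base) auto
  finally show "c \<in> fun_vs.span ((\<lambda>y x. if x = y then 1 else 0) ` K)" .
qed

text \<open>Confinement to a finite support makes the basis finite, so that
  \<open>fun_vs.dim\<close> is a genuine count. \<open>V\<close> may be any set, not only a
  subspace.\<close>

lemma chains_on_basis_exists:
  assumes "finite K" "V \<subseteq> chains_on K"
  obtains B where "B \<subseteq> V" "finite B" "fun_vs.independent B" "V \<subseteq> fun_vs.span B"
    "card B = fun_vs.dim V"
proof -
  obtain B where B: "B \<subseteq> V" "fun_vs.independent B" "V \<subseteq> fun_vs.span B" "card B = fun_vs.dim V"
    using fun_vs.basis_exists by blast
  have "B \<subseteq> fun_vs.span ((\<lambda>y x. if x = y then 1 else 0) ` K)"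
    using B(1) assms chains_on_subset_span by blast
  then have "finite B"
    using fun_vs.independent_span_bound[OF _ B(2)] assms(1) by blast
  with B that show thesis by blast
qed

lemma dim_chains_on_le_insert:
  assumes "finite K" "W \<subseteq> chains_on K" "V \<subseteq> fun_vs.span (insert u W)"
  shows "fun_vs.dim V \<le> Suc (fun_vs.dim W)"
proof -
  obtain B where B: "B \<subseteq> W" "finite B" "fun_vs.independent B" "W \<subseteq> fun_vs.span B"
    "card B = fun_vs.dim W"
    using chains_on_basis_exists[OF assms(1,2)] by blast
  have "insert u W \<subseteq> fun_vs.span (insert u B)"
    using B(4) fun_vs.span_mono[of B "insert u B"] by (auto intro: fun_vs.span_base)
  then have "V \<subseteq> fun_vs.span (insert u B)"
    using assms(3) fun_vs.span_minimal[OF _ fun_vs.subspace_span] by blast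
  then have "fun_vs.dim V \<le> card (insert u B)"
    using B(2) by (intro fun_vs.dim_le_card) auto
  also have "\<dots> \<le> Suc (fun_vs.dim W)"
    using B(2,5) by (simp add: card_insert_if)
  finally show ?thesis .
qed

lemma dim_chains_on_mono:
  assumes "finite K" "W \<subseteq> chains_on K" "V \<subseteq> W"
  shows "fun_vs.dim V \<le> fun_vs.dim W"
proof -
  obtain B where B: "B \<subseteq> W" "finite B" "fun_vs.independent B" "W \<subseteq> fun_vs.span B"
    "card B = fun_vs.dim W"
    using chains_on_basis_exists[OF assms(1,2)] by blast
  then show ?thesis
    using fun_vs.dim_le_card[of V B] assms(3) by auto
qed

text \<open>Each equation \<open>c x = 0\<close> is one linear condition and cuts the dimension by
  at most one.\<close>

lemma dim_le_dim_vanishing: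
  assumes "finite K" "V \<subseteq> chains_on K" "fun_vs.subspace V" "finite D"
  shows "fun_vs.dim V \<le> fun_vs.dim {c \<in> V. \<forall>x\<in>D. c x = 0} + card D"
  using assms(4)
proof (induction D rule: finite_induct)
  case empty
  then show ?case by simp
next
  case (insert y D)
  define W where "W = {c \<in> V. \<forall>x\<in>D. c x = 0}"
  define W' where "W' = {c \<in> V. \<forall>x\<in>insert y D. c x = 0}"
  have subsp: "fun_vs.subspace W"
    using assms(3) by (auto simp: W_def fun_vs.subspace_def)
  have W'K: "W' \<subseteq> chains_on K"
    using assms(2) by (auto simp: W'_def)
  have "\<exists>u. W \<subseteq> fun_vs.span (insert u W')"
  \<comment> \<open>An element \<open>u\<close> not vanishing at \<open>y\<close> serves as pivot:
    subtracting the right multiple of it brings every member of \<open>W\<close> into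
    \<open>W'\<close>.\<close>
  proof (cases "\<exists>u\<in>W. u y \<noteq> 0")
    case True
    then obtain u where u: "u \<in> W" "u y \<noteq> 0" by blast
    have "c \<in> fun_vs.span (insert u W')" if "c \<in> W" for c
    proof -
      have "c - (\<lambda>x. (c y / u y) * u x) \<in> W"
        using subsp that u(1) fun_vs.subspace_diff fun_vs.subspace_scale by blast
      then have "c - (\<lambda>x. (c y / u y) * u x) \<in> W'"
        using u(2) by (auto simp: W_def W'_def)
      then show ?thesis
        unfolding fun_vs.span_breakdown_eq using fun_vs.span_base by blast
    qed
    then show ?thesis by blast
  next
    case False
    then have "W \<subseteq> W'" by (auto simp: W_def W'_def)
    then show ?thesis using fun_vs.span_superset by blast
  qed
  then obtain u where "W \<subseteq> fun_vs.span (insert u W')" ..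
  then have "fun_vs.dim W \<le> Suc (fun_vs.dim W')"
    by (rule dim_chains_on_le_insert[OF assms(1) W'K])
  with insert show ?case
    unfolding W_def[symmetric] W'_def[symmetric] by simp
qed

text \<open>Disjoint supports make the sum direct. Membership of 0 places \<open>V1\<close> and
  \<open>V2\<close> inside the set of sums, since neither is assumed to be a subspace.\<close>

lemma dim_chains_on_direct_sum:
  assumes "finite K1" "finite K2" "K1 \<inter> K2 = {}"
    and V: "V1 \<subseteq> chains_on K1" "V2 \<subseteq> chains_on K2"
    and zero: "0 \<in> V1" "0 \<in> V2"
  shows "fun_vs.dim {a + b | a b. a \<in> V1 \<and> b \<in> V2} = fun_vs.dim V1 + fun_vs.dim V2"
proof -
  obtain B1 where B1: "B1 \<subseteq> V1" "finite B1" "fun_vs.independent B1" "V1 \<subseteq> fun_vs.span B1"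
    "card B1 = fun_vs.dim V1"
    using chains_on_basis_exists[OF assms(1) V(1)] by blast
  obtain B2 where B2: "B2 \<subseteq> V2" "finite B2" "fun_vs.independent B2" "V2 \<subseteq> fun_vs.span B2"
    "card B2 = fun_vs.dim V2"
    using chains_on_basis_exists[OF assms(2) V(2)] by blast
  have z1: "b x = 0" if "b \<in> B1" "x \<in> K2" for b x
    using that B1(1) V(1) assms(3) by (auto simp: chains_on_def)
  have z2: "b x = 0" if "b \<in> B2" "x \<in> K1" for b x
    using that B2(1) V(2) assms(3) by (auto simp: chains_on_def)
  \<comment> \<open>A common basis vector would vanish both on \<open>K1\<close> and off it, hence
    be 0, which no independent set contains.\<close>
  have disj: "B1 \<inter> B2 = {}"
  proof (rule ccontr)
    assume "B1 \<inter> B2 \<noteq> {}"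
    then obtain b where b: "b \<in> B1" "b \<in> B2" by blast
    have "b x = 0" for x
    proof (cases "x \<in> K1")
      case False
      then show ?thesis using b(1) B1(1) V(1) by (auto simp: chains_on_def)
    qed (use z2 b in auto)
    then have "b = 0" by auto
    then show False
      using b(1) B1(3) fun_vs.dependent_zero by blast
  qed
  let ?V = "{a + b | a b. a \<in> V1 \<and> b \<in> V2}"
  have "a + b \<in> fun_vs.span (B1 \<union> B2)" if "a \<in> V1" "b \<in> V2" for a b
    using that B1(4) B2(4) fun_vs.span_mono[of B1 "B1 \<union> B2"] fun_vs.span_mono[of B2 "B1 \<union> B2"]
    by (intro fun_vs.span_add) auto
  then have sp: "?V \<subseteq> fun_vs.span (B1 \<union> B2)"
    by blast
  have card: "card (B1 \<union> B2) = fun_vs.dim V1 + fun_vs.dim V2"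
    using B1 B2 disj by (simp add: card_Un_disjoint)
  have "B1 \<subseteq> ?V"
  proof
    fix b assume "b \<in> B1"
    then have "b + 0 \<in> ?V" using B1(1) zero by blast
    then show "b \<in> ?V" by simp
  qed
  moreover have "B2 \<subseteq> ?V"
  proof
    fix b assume "b \<in> B2"
    then have "0 + b \<in> ?V" using B2(1) zero by blast
    then show "b \<in> ?V" by simp
  qed
  ultimately have sub: "B1 \<union> B2 \<subseteq> ?V" by blast
  have "fun_vs.independent (B1 \<union> B2)"
  proof (rule fun_vs.independent_if_scalars_zero)
    fix f v
    assume sum0: "(\<Sum>b\<in>B1 \<union> B2. (\<lambda>x. f b * b x)) = 0" and v: "v \<in> B1 \<union> B2"
    have split: "(\<Sum>b\<in>B1. f b * b x) + (\<Sum>b\<in>B2. f b * b x) = 0" for x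
    proof -
      have "(\<Sum>b\<in>B1 \<union> B2. (\<lambda>x. f b * b x)) x = 0"
        by (simp only: sum0 zero_fun_def)
      then show ?thesis
        using B1(2) B2(2) disj by (simp add: sum_fun_apply sum.union_disjoint)
    qed
    \<comment> \<open>On \<open>K1\<close> the second half of the relation vanishes; off
      \<open>K1\<close> every term of the first half does. The relation therefore splits.\<close>
    have s1: "(\<Sum>b\<in>B1. f b * b x) = 0" for x
    proof (cases "x \<in> K1")
      case True
      then have "(\<Sum>b\<in>B2. f b * b x) = 0"
        using z2 by (intro sum.neutral) auto
      then show ?thesis using split[of x] by simp
    next
      case False
      then show ?thesis
        using B1(1) V(1) by (intro sum.neutral) (auto simp: chains_on_def)
    qed
    then have s2: "(\<Sum>b\<in>B2. f b * b x) = 0" for x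
      using split[of x] by simp
    have "(\<Sum>b\<in>B1. (\<lambda>x. f b * b x)) = 0" "(\<Sum>b\<in>B2. (\<lambda>x. f b * b x)) = 0"
      using s1 s2 by (auto simp: fun_eq_iff sum_fun_apply)
    then show "f v = 0"
      using v fun_vs.independentD[OF B1(3,2) order_refl] fun_vs.independentD[OF B2(3,2) order_refl]
      by blast
  qed (use B1(2) B2(2) in auto)
  then show "fun_vs.dim ?V = fun_vs.dim V1 + fun_vs.dim V2"
    using fun_vs.dim_unique[OF sub sp _ card] by simp
qed

text \<open>Precomposition with any \<open>g\<close> is linear, so the images of a basis span the
  image. It will be used with \<open>g\<close> a translation.\<close>

lemma dim_comp_le:
  assumes "finite K" "V \<subseteq> chains_on K"
  shows "fun_vs.dim ((\<lambda>c. c \<circ> g) ` V) \<le> fun_vs.dim V"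
proof -
  obtain B where B: "B \<subseteq> V" "finite B" "fun_vs.independent B" "V \<subseteq> fun_vs.span B"
    "card B = fun_vs.dim V"
    using chains_on_basis_exists[OF assms] by blast
  have "c \<circ> g \<in> fun_vs.span ((\<lambda>c. c \<circ> g) ` B)" if "c \<in> fun_vs.span B" for c
    using that
  proof (induction rule: fun_vs.span_induct_alt)
    case base
    have "(0 :: 'a \<Rightarrow> real) \<circ> g = 0" by auto
    then show ?case by (metis fun_vs.span_zero)
  next
    case (step r x y)
    have "((\<lambda>z. r * x z) + y) \<circ> g = (\<lambda>z. r * (x \<circ> g) z) + (y \<circ> g)" by auto
    moreover have "x \<circ> g \<in> fun_vs.span ((\<lambda>c. c \<circ> g) ` B)"
      using step(1) by (intro fun_vs.span_base imageI)
    ultimately show ?case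
      using step(2) fun_vs.span_add fun_vs.span_scale by metis
  qed
  then have "fun_vs.dim ((\<lambda>c. c \<circ> g) ` V) \<le> card ((\<lambda>c. c \<circ> g) ` B)"
    using B by (intro fun_vs.dim_le_card) auto
  then show ?thesis
    using card_image_le[OF B(2), of "\<lambda>c. c \<circ> g"] B(5) by simp
qed

section \<open>Persistent Betti numbers of finite sets of cubes\<close>

definition cycles_on :: "nat \<Rightarrow> ecube set \<Rightarrow> chain set" where
  "cycles_on d S = {c \<in> chains_on S. bdry d c = (\<lambda>_. 0)}"

definition bounding_on :: "nat \<Rightarrow> ecube set \<Rightarrow> ecube set \<Rightarrow> chain set" where
  "bounding_on d S T = cycles_on d S \<inter> bdry d ` chains_on T"

text \<open>\<open>S\<close> stands for the q-cubes at time s and \<open>T\<close> for the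
  (q+1)-cubes at time t, but the two sets are unrelated here, so cubes can be added to either one
  alone. For finite \<open>S\<close> the subtraction is not truncated, because the bounding cycles
  are among the cycles.\<close>

definition betti_on :: "nat \<Rightarrow> ecube set \<Rightarrow> ecube set \<Rightarrow> nat" where
  "betti_on d S T = fun_vs.dim (cycles_on d S) - fun_vs.dim (bounding_on d S T)"

lemma chains_eq_chains_on:
  assumes "finite (cubes_of d q X)"
  shows "chains d q X = chains_on (cubes_of d q X)"
proof -
  have "finite {Q. c Q \<noteq> 0}" if "\<forall>Q. c Q \<noteq> 0 \<longrightarrow> Q \<in> cubes_of d q X" for c :: chain
    by (rule finite_subset[OF _ assms]) (use that in auto)
  then show ?thesis
    by (auto simp: chains_def chains_on_def)
qed

lemma pers_betti_eq_betti_on: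
  assumes "finite (cubes_of d q Xs)" "finite (cubes_of d (Suc q) Xt)"
  shows "pers_betti d q Xs Xt = betti_on d (cubes_of d q Xs) (cubes_of d (Suc q) Xt)"
  using assms
  by (simp add: pers_betti_def betti_on_def bounding_on_def cycles_on_def cycles_def boundaries_def
      chains_eq_chains_on chain_dim_def)

section \<open>Linearity of the boundary map\<close>

lemma bdry_eq_sum:
  assumes "finite K" "c \<in> chains_on K"
  shows "bdry d c P = (\<Sum>Q\<in>K. c Q * incid d Q P)"
  unfolding bdry_def using assms
  by (intro sum.mono_neutral_left) (auto simp: chains_on_def)

lemma chains_on_add: "a \<in> chains_on K \<Longrightarrow> b \<in> chains_on K \<Longrightarrow> a + b \<in> chains_on K"
  using subspace_chains_on[of K] fun_vs.subspace_add by blast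

lemma chains_on_scale: "a \<in> chains_on K \<Longrightarrow> (\<lambda>x. r * a x) \<in> chains_on K"
  by (auto simp: chains_on_def)

lemma bdry_add:
  assumes "finite K" "a \<in> chains_on K" "b \<in> chains_on K"
  shows "bdry d (a + b) = bdry d a + bdry d b"
  using assms
  by (auto simp: fun_eq_iff bdry_eq_sum[of K] chains_on_add sum.distrib algebra_simps)

lemma bdry_scale:
  assumes "finite K" "a \<in> chains_on K"
  shows "bdry d (\<lambda>x. r * a x) = (\<lambda>x. r * bdry d a x)"
  using assms
  by (auto simp: fun_eq_iff bdry_eq_sum[of K] chains_on_scale sum_distrib_left mult.assoc)

lemma bdry_zero: "bdry d 0 = 0"
  by (auto simp: bdry_def)

lemma zero_in_chains_on: "0 \<in> chains_on K"
  by (auto simp: chains_on_def)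

lemma subspace_cycles_on:
  assumes "finite S"
  shows "fun_vs.subspace (cycles_on d S)"
  unfolding fun_vs.subspace_def cycles_on_def
  using assms
  by (auto simp: bdry_add[of S] bdry_scale[of S] bdry_zero chains_on_add chains_on_scale
      zero_in_chains_on zero_fun_def[symmetric])

lemma subspace_bounding_on:
  assumes "finite S" "finite T"
  shows "fun_vs.subspace (bounding_on d S T)"
  unfolding bounding_on_def
proof (rule fun_vs.subspace_inter[OF subspace_cycles_on[OF assms(1)]])
  show "fun_vs.subspace (bdry d ` chains_on T)"
    unfolding fun_vs.subspace_def
  proof safe
    show "0 \<in> bdry d ` chains_on T"
      using bdry_zero[of d] zero_in_chains_on[of T] by force
  next
    fix a b :: chain assume "a \<in> chains_on T" "b \<in> chains_on T"
    then show "bdry d a + bdry d b \<in> bdry d ` chains_on T"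
      using bdry_add[OF assms(2), of a b d, symmetric] chains_on_add by auto
  next
    fix r and a :: chain assume "a \<in> chains_on T"
    then show "(\<lambda>x. r * bdry d a x) \<in> bdry d ` chains_on T"
      using bdry_scale[OF assms(2), of a d r, symmetric] chains_on_scale by auto
  qed
qed

lemma cycles_on_subset: "cycles_on d S \<subseteq> chains_on S"
  by (auto simp: cycles_on_def)

lemma bounding_on_subset_cycles: "bounding_on d S T \<subseteq> cycles_on d S"
  by (auto simp: bounding_on_def)

lemma bounding_on_subset: "bounding_on d S T \<subseteq> chains_on S"
  using bounding_on_subset_cycles cycles_on_subset by blast

lemma dim_bounding_on_le_cycles:
  "finite S \<Longrightarrow> fun_vs.dim (bounding_on d S T) \<le> fun_vs.dim (cycles_on d S)"
  using dim_chains_on_mono[OF _ cycles_on_subset bounding_on_subset_cycles] .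

section \<open>Lipschitz dependence on the sets of cubes\<close>

lemma dim_bounding_on_insert:
  assumes "finite S" "finite T"
  shows "fun_vs.dim (bounding_on d S (insert Q T)) \<le> Suc (fun_vs.dim (bounding_on d S T))"
proof -
  have fin: "finite (insert Q T)" using assms by simp
  \<comment> \<open>Only a chain through \<open>Q\<close> whose boundary is a cycle on
    \<open>S\<close> can create a new bounding cycle. If there is one, its boundary is the single
    extra generator; if there is none, nothing is gained.\<close>
  have "\<exists>u. bounding_on d S (insert Q T) \<subseteq> fun_vs.span (insert u (bounding_on d S T))"
  proof (cases "\<exists>e\<in>chains_on (insert Q T). e Q \<noteq> 0 \<and> bdry d e \<in> cycles_on d S")
    case True
    then obtain e where e: "e \<in> chains_on (insert Q T)" "e Q \<noteq> 0" "bdry d e \<in> cycles_on d S"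
      by blast
    have "c \<in> fun_vs.span (insert (bdry d e) (bounding_on d S T))"
      if c: "c \<in> bounding_on d S (insert Q T)" for c
    proof -
      have f3: "c \<in> cycles_on d S"
        using c by (simp add: bounding_on_def)
      obtain f where f: "f \<in> chains_on (insert Q T)" "c = bdry d f"
        using c unfolding bounding_on_def by blast
      \<comment> \<open>This multiple of \<open>e\<close> cancels the coefficient of
        \<open>Q\<close> in \<open>f\<close>, leaving a chain on \<open>T\<close>.\<close>
      define r where "r = f Q / e Q"
      have g: "f - (\<lambda>x. r * e x) \<in> chains_on T"
        unfolding chains_on_def
      proof (intro CollectI allI impI)
        fix x assume x: "(f - (\<lambda>x. r * e x)) x \<noteq> 0"
        then have "x \<noteq> Q" using e(2) by (auto simp: r_def)
        moreover have "f x \<noteq> 0 \<or> e x \<noteq> 0" using x by auto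
        ultimately show "x \<in> T" using f(1) e(1) by (auto simp: chains_on_def)
      qed
      have "bdry d f = bdry d ((f - (\<lambda>x. r * e x)) + (\<lambda>x. r * e x))"
        by simp
      also have "\<dots> = bdry d (f - (\<lambda>x. r * e x)) + (\<lambda>x. r * bdry d e x)"
        using g chains_on_mono[of T "insert Q T"] e(1)
        by (subst bdry_add[OF fin]) (auto simp: chains_on_scale bdry_scale[OF fin])
      finally have eq: "c - (\<lambda>x. r * bdry d e x) = bdry d (f - (\<lambda>x. r * e x))"
        using f(2) by simp
      have "c - (\<lambda>x. r * bdry d e x) \<in> cycles_on d S"
        using f3 e(3) subspace_cycles_on[OF assms(1)] fun_vs.subspace_diff fun_vs.subspace_scale
        by blast
      then have "c - (\<lambda>x. r * bdry d e x) \<in> bounding_on d S T"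
        using eq g by (auto simp: bounding_on_def)
      then show ?thesis
        unfolding fun_vs.span_breakdown_eq using fun_vs.span_base by blast
    qed
    then show ?thesis by blast
  next
    case False
    have "bounding_on d S (insert Q T) \<subseteq> bounding_on d S T"
    proof
      fix c assume c: "c \<in> bounding_on d S (insert Q T)"
      then have f3: "c \<in> cycles_on d S"
        by (simp add: bounding_on_def)
      obtain f where f: "f \<in> chains_on (insert Q T)" "c = bdry d f"
        using c unfolding bounding_on_def by blast
      then have "f Q = 0" using False f3 by blast
      then have "f \<in> chains_on T" using f(1) by (auto simp: chains_on_def)
      then show "c \<in> bounding_on d S T" using f f3 by (auto simp: bounding_on_def)
    qed
    then show ?thesis using fun_vs.span_superset by blast
  qed
  then obtain u where "bounding_on d S (insert Q T) \<subseteq> fun_vs.span (insert u (bounding_on d S T))" ..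
  then show ?thesis
    by (rule dim_chains_on_le_insert[OF assms(1) bounding_on_subset])
qed

lemma dim_bounding_on_le_right:
  assumes "finite S" "finite T'" "T \<subseteq> T'"
  shows "fun_vs.dim (bounding_on d S T') \<le> fun_vs.dim (bounding_on d S T) + card (T' - T)"
proof -
  have "finite T" using assms finite_subset by blast
  have "fun_vs.dim (bounding_on d S (T \<union> D)) \<le> fun_vs.dim (bounding_on d S T) + card D"
    if "finite D" for D
    using that
  proof (induction D rule: finite_induct)
    case (insert Q D)
    then show ?case
      using dim_bounding_on_insert[OF assms(1), of "T \<union> D" d Q] \<open>finite T\<close> by simp
  qed simp
  from this[of "T' - T"] show ?thesis
    using assms by (simp add: Un_absorb1)
qed

text \<open>A cycle on \<open>S'\<close> that vanishes on \<open>S' - S\<close> is exactly a cycle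
  on \<open>S\<close>, so at most \<open>card (S' - S)\<close> linear conditions separate the two
  spaces. The same argument handles bounding cycles below.\<close>

lemma dim_cycles_on_le:
  assumes "finite S'" "S \<subseteq> S'"
  shows "fun_vs.dim (cycles_on d S') \<le> fun_vs.dim (cycles_on d S) + card (S' - S)"
proof -
  have "{c \<in> cycles_on d S'. \<forall>x\<in>S' - S. c x = 0} = cycles_on d S"
    using assms(2) by (auto simp: cycles_on_def chains_on_def)
  then show ?thesis
    using dim_le_dim_vanishing[OF assms(1) cycles_on_subset subspace_cycles_on[OF assms(1)], of "S' - S" d]
      assms(1) by simp
qed

lemma dim_bounding_on_le_left:
  assumes "finite S'" "S \<subseteq> S'" "finite T"
  shows "fun_vs.dim (bounding_on d S' T) \<le> fun_vs.dim (bounding_on d S T) + card (S' - S)"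
proof -
  have "{c \<in> bounding_on d S' T. \<forall>x\<in>S' - S. c x = 0} = bounding_on d S T"
    using assms(2) by (auto simp: bounding_on_def cycles_on_def chains_on_def)
  then show ?thesis
    using dim_le_dim_vanishing[OF assms(1) bounding_on_subset subspace_bounding_on[OF assms(1,3)], of "S' - S" d]
      assms(1) by simp
qed

text \<open>The set \<open>S\<close> enters both dimensions and \<open>T\<close> only the second;
  adding up the changes gives the coefficients 2 and 1.\<close>

lemma betti_on_Lipschitz:
  assumes "finite S'" "S \<subseteq> S'" "finite T'" "T \<subseteq> T'"
  shows "\<bar>real (betti_on d S' T') - real (betti_on d S T)\<bar>
    \<le> 2 * real (card (S' - S)) + real (card (T' - T))"
proof -
  have fin: "finite S" "finite T" using assms finite_subset by blast+
  have "fun_vs.dim (cycles_on d S) \<le> fun_vs.dim (cycles_on d S')"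
    using assms by (intro dim_chains_on_mono[OF assms(1) cycles_on_subset])
      (auto simp: cycles_on_def chains_on_def)
  moreover have "fun_vs.dim (bounding_on d S T) \<le> fun_vs.dim (bounding_on d S' T')"
    using assms chains_on_mono[OF assms(4)] by (intro dim_chains_on_mono[OF assms(1) bounding_on_subset])
      (auto simp: bounding_on_def cycles_on_def chains_on_def)
  moreover have "fun_vs.dim (cycles_on d S') \<le> fun_vs.dim (cycles_on d S) + card (S' - S)"
    by (rule dim_cycles_on_le[OF assms(1,2)])
  moreover have "fun_vs.dim (bounding_on d S' T') \<le> fun_vs.dim (bounding_on d S T') + card (S' - S)"
    by (rule dim_bounding_on_le_left[OF assms(1-3)])
  moreover have "fun_vs.dim (bounding_on d S T') \<le> fun_vs.dim (bounding_on d S T) + card (T' - T)"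
    by (rule dim_bounding_on_le_right[OF fin(1) assms(3,4)])
  moreover have "fun_vs.dim (bounding_on d S T) \<le> fun_vs.dim (cycles_on d S)"
    "fun_vs.dim (bounding_on d S' T') \<le> fun_vs.dim (cycles_on d S')"
    using fin assms by (intro dim_bounding_on_le_cycles; simp)+
  ultimately show ?thesis
    unfolding betti_on_def by linarith
qed

section \<open>Additivity over disjoint face-closed sets\<close>

definition face_closed :: "nat \<Rightarrow> ecube set \<Rightarrow> bool" where
  "face_closed d K \<longleftrightarrow> (\<forall>Q\<in>K. \<forall>P. incid d Q P \<noteq> 0 \<longrightarrow> P \<in> K)"

lemma bdry_in_chains_on:
  assumes "finite K" "face_closed d K" "c \<in> chains_on K"
  shows "bdry d c \<in> chains_on K"
proof -
  have "bdry d c P = 0" if "P \<notin> K" for P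
    unfolding bdry_eq_sum[OF assms(1,3)]
    using assms(2) that by (intro sum.neutral) (auto simp: face_closed_def)
  then show ?thesis by (auto simp: chains_on_def)
qed

lemma chains_on_Un_decompose:
  assumes "c \<in> chains_on (S1 \<union> S2)"
  obtains a b where "a \<in> chains_on S1" "b \<in> chains_on S2" "c = a + b"
proof
  show "(\<lambda>x. if x \<in> S1 then c x else 0) \<in> chains_on S1" by (auto simp: chains_on_def)
  show "(\<lambda>x. if x \<in> S1 then 0 else c x) \<in> chains_on S2" using assms by (auto simp: chains_on_def)
qed auto

lemma chains_on_decompose_unique:
  assumes "K1 \<inter> K2 = {}" "a \<in> chains_on K1" "a' \<in> chains_on K1" "b \<in> chains_on K2" "b' \<in> chains_on K2"
    "a + b = a' + b'"
  shows "a = a'" "b = b'"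
proof -
  have "a x = a' x \<and> b x = b' x" for x
  proof -
    have "a x + b x = a' x + b' x" using assms(6) by (metis plus_fun_apply)
    moreover have "x \<notin> K1 \<or> x \<notin> K2" using assms(1) by blast
    then have "(a x = 0 \<and> a' x = 0) \<or> (b x = 0 \<and> b' x = 0)"
      using assms(2-5) by (auto simp: chains_on_def)
    ultimately show ?thesis by auto
  qed
  then show "a = a'" "b = b'" by auto
qed

text \<open>Closure under faces keeps the boundary of a chain on \<open>K1\<close> in
  \<open>K1\<close>, and likewise for \<open>K2\<close>, so cycles and bounding cycles both split
  along the disjoint union. Only the ambient sets have to be closed; the sets of living cubes inside
  them are arbitrary.\<close>

lemma betti_on_Un:
  assumes fin: "finite K1" "finite K2" and disj: "K1 \<inter> K2 = {}"
    and fc: "face_closed d K1" "face_closed d K2"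
    and sub: "S1 \<subseteq> K1" "T1 \<subseteq> K1" "S2 \<subseteq> K2" "T2 \<subseteq> K2"
  shows "betti_on d (S1 \<union> S2) (T1 \<union> T2) = betti_on d S1 T1 + betti_on d S2 T2"
proof -
  have finST: "finite S1" "finite S2" "finite T1" "finite T2"
    using fin sub finite_subset by blast+
  have S: "chains_on S1 \<subseteq> chains_on K1" "chains_on S2 \<subseteq> chains_on K2"
    "chains_on S1 \<subseteq> chains_on (S1 \<union> S2)" "chains_on S2 \<subseteq> chains_on (S1 \<union> S2)"
    and T: "chains_on T1 \<subseteq> chains_on K1" "chains_on T2 \<subseteq> chains_on K2"
    "chains_on T1 \<subseteq> chains_on (T1 \<union> T2)" "chains_on T2 \<subseteq> chains_on (T1 \<union> T2)"
    using sub by (auto intro!: chains_on_mono)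
  have addS: "bdry d (a + b) = bdry d a + bdry d b" if "a \<in> chains_on S1" "b \<in> chains_on S2" for a b
    using that S finST by (intro bdry_add[of "S1 \<union> S2"]) auto
  have addT: "bdry d (a + b) = bdry d a + bdry d b" if "a \<in> chains_on T1" "b \<in> chains_on T2" for a b
    using that T finST by (intro bdry_add[of "T1 \<union> T2"]) auto
  have cyc: "cycles_on d (S1 \<union> S2) = {a + b | a b. a \<in> cycles_on d S1 \<and> b \<in> cycles_on d S2}"
    (is "?L = ?R")
  proof
    show "?L \<subseteq> ?R"
    proof
      fix c assume c: "c \<in> ?L"
      then obtain a b where ab: "a \<in> chains_on S1" "b \<in> chains_on S2" "c = a + b"
        using chains_on_Un_decompose[of c S1 S2] by (auto simp: cycles_on_def)
      have "bdry d a + bdry d b = 0 + 0"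
        using c addS[OF ab(1,2)] ab(3) by (simp add: cycles_on_def zero_fun_def)
      then have "bdry d a = 0" "bdry d b = 0"
        using chains_on_decompose_unique[OF disj, of "bdry d a" 0 "bdry d b" 0] ab S
          bdry_in_chains_on[OF fin(1) fc(1)] bdry_in_chains_on[OF fin(2) fc(2)] zero_in_chains_on
        by blast+
      then show "c \<in> ?R" using ab by (auto simp: cycles_on_def zero_fun_def)
    qed
    show "?R \<subseteq> ?L"
    proof
      fix c assume "c \<in> ?R"
      then obtain a b where ab: "c = a + b" "a \<in> cycles_on d S1" "b \<in> cycles_on d S2" by blast
      then have "a \<in> chains_on S1" "b \<in> chains_on S2"
        using cycles_on_subset by blast+
      then show "c \<in> ?L"
        using ab S addS chains_on_add[of a "S1 \<union> S2" b] by (auto simp: cycles_on_def)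
    qed
  qed
  have bnd: "bounding_on d (S1 \<union> S2) (T1 \<union> T2)
      = {a + b | a b. a \<in> bounding_on d S1 T1 \<and> b \<in> bounding_on d S2 T2}" (is "?L = ?R")
  proof
    show "?L \<subseteq> ?R"
    proof
      fix c assume c: "c \<in> ?L"
      \<comment> \<open>Two decompositions of \<open>c\<close> are compared: one as a cycle, the
        other as the boundary of a chain on \<open>T1 \<union> T2\<close>. Uniqueness over
        \<open>K1\<close> and \<open>K2\<close> identifies their parts.\<close>
      then obtain a b where ab: "a \<in> cycles_on d S1" "b \<in> cycles_on d S2" "c = a + b"
        unfolding bounding_on_def cyc by blast
      obtain e where e: "e \<in> chains_on (T1 \<union> T2)" "c = bdry d e"
        using c by (auto simp: bounding_on_def)
      obtain e1 e2 where e12: "e1 \<in> chains_on T1" "e2 \<in> chains_on T2" "e = e1 + e2"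
        using chains_on_Un_decompose[OF e(1)] by blast
      have "a + b = bdry d e1 + bdry d e2"
        using ab(3) e(2) e12 addT by simp
      moreover have "a \<in> chains_on K1" "b \<in> chains_on K2"
        using ab(1,2) S cycles_on_subset by blast+
      moreover have "bdry d e1 \<in> chains_on K1" "bdry d e2 \<in> chains_on K2"
        using e12 T bdry_in_chains_on[OF fin(1) fc(1)] bdry_in_chains_on[OF fin(2) fc(2)] by blast+
      ultimately have "a = bdry d e1" "b = bdry d e2"
        using chains_on_decompose_unique[OF disj] by metis+
      then show "c \<in> ?R" using ab e12 by (auto simp: bounding_on_def)
    qed
    show "?R \<subseteq> ?L"
    proof
      fix c assume "c \<in> ?R"
      then obtain e1 e2 where e: "e1 \<in> chains_on T1" "e2 \<in> chains_on T2" "c = bdry d e1 + bdry d e2"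
        "bdry d e1 \<in> cycles_on d S1" "bdry d e2 \<in> cycles_on d S2"
        by (auto simp: bounding_on_def)
      then have "c = bdry d (e1 + e2)"
        using addT by simp
      moreover have "e1 + e2 \<in> chains_on (T1 \<union> T2)"
        by (rule chains_on_add) (use e T in blast)+
      ultimately show "c \<in> ?L"
        unfolding bounding_on_def cyc using e by blast
    qed
  qed
  have zero: "0 \<in> cycles_on d S1" "0 \<in> cycles_on d S2" "0 \<in> bounding_on d S1 T1" "0 \<in> bounding_on d S2 T2"
    using finST subspace_cycles_on subspace_bounding_on fun_vs.subspace_0 by blast+
  have "fun_vs.dim (cycles_on d (S1 \<union> S2)) = fun_vs.dim (cycles_on d S1) + fun_vs.dim (cycles_on d S2)"
    unfolding cyc using S cycles_on_subset zero
    by (intro dim_chains_on_direct_sum[OF fin disj]) blast+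
  moreover have "fun_vs.dim (bounding_on d (S1 \<union> S2) (T1 \<union> T2))
      = fun_vs.dim (bounding_on d S1 T1) + fun_vs.dim (bounding_on d S2 T2)"
    unfolding bnd using S bounding_on_subset zero
    by (intro dim_chains_on_direct_sum[OF fin disj]) blast+
  moreover have "fun_vs.dim (bounding_on d S1 T1) \<le> fun_vs.dim (cycles_on d S1)"
    "fun_vs.dim (bounding_on d S2 T2) \<le> fun_vs.dim (cycles_on d S2)"
    using finST by (intro dim_bounding_on_le_cycles; simp)+
  ultimately show ?thesis
    unfolding betti_on_def by linarith
qed

section \<open>Translation invariance\<close>

lemma shift_uminus_shift: "shift d (-z) (shift d z Q) = Q" "shift d z (shift d (-z) Q) = Q"
  by (auto simp: shift_def fun_eq_iff)

lemma inj_shift: "inj (shift d z)"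
  by (metis injI shift_uminus_shift(1))

text \<open>The signs depend only on which factors are nondegenerate, and injectivity of the shift
  preserves the comparison of \<open>P\<close> with the faces.\<close>

lemma incid_shift: "incid d (shift d z Q) (shift d z P) = incid d Q P"
proof -
  have upd: "(shift d z Q)(i := (fst (shift d z Q i) + r, False)) = shift d z (Q(i := (fst (Q i) + r, False)))"
    if "i < d" for i r
    using that by (auto simp: shift_def fun_eq_iff)
  have snd: "snd (shift d z Q i) = snd (Q i)" for i
    by (simp add: shift_def)
  show ?thesis
    unfolding incid_def snd
    using upd[of _ 1] upd[of _ 0]
    by (intro sum.cong refl) (simp add: inj_eq[OF inj_shift])
qed

lemma chains_on_comp_shift:
  assumes "finite S" "c \<in> chains_on (shift d z ` S)"
  shows "c \<circ> shift d z \<in> chains_on S" "bdry d (c \<circ> shift d z) = bdry d c \<circ> shift d z"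
proof -
  show in_S: "c \<circ> shift d z \<in> chains_on S"
    using assms(2) inj_shift[of d z] by (auto simp: chains_on_def inj_def)
  show "bdry d (c \<circ> shift d z) = bdry d c \<circ> shift d z"
  proof
    fix P
    have "bdry d c (shift d z P) = (\<Sum>Q\<in>shift d z ` S. c Q * incid d Q (shift d z P))"
      using assms by (intro bdry_eq_sum) auto
    also have "\<dots> = (\<Sum>Q\<in>S. c (shift d z Q) * incid d (shift d z Q) (shift d z P))"
      using inj_shift[of d z] by (subst sum.reindex) (auto simp: inj_on_def inj_def)
    also have "\<dots> = bdry d (c \<circ> shift d z) P"
      using bdry_eq_sum[OF assms(1) in_S] by (simp add: incid_shift)
    finally show "bdry d (c \<circ> shift d z) P = (bdry d c \<circ> shift d z) P" by simp
  qed
qed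

lemma comp_shift_uminus: "c \<circ> shift d z \<circ> shift d (-z) = c"
  by (simp add: fun_eq_iff shift_uminus_shift)

text \<open>Pulling a chain back along the shift carries it from the translated sets to the original
  ones. One inequality is enough, since the other is the same statement for
  \<open>-z\<close>.\<close>

lemma dim_shift_le:
  assumes "finite S" "finite T"
  shows "fun_vs.dim (cycles_on d (shift d z ` S)) \<le> fun_vs.dim (cycles_on d S)"
    and "fun_vs.dim (bounding_on d (shift d z ` S) (shift d z ` T)) \<le> fun_vs.dim (bounding_on d S T)"
proof -
  have cyc: "c \<circ> shift d z \<in> cycles_on d S" if "c \<in> cycles_on d (shift d z ` S)" for c
    using that chains_on_comp_shift[OF assms(1), of c d z] by (auto simp: cycles_on_def)
  have bnd: "c \<circ> shift d z \<in> bounding_on d S T"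
    if c: "c \<in> bounding_on d (shift d z ` S) (shift d z ` T)" for c
  proof -
    obtain e where e: "c = bdry d e" "e \<in> chains_on (shift d z ` T)"
      using c by (auto simp: bounding_on_def)
    then have "c \<circ> shift d z \<in> bdry d ` chains_on T"
      using chains_on_comp_shift[OF assms(2), of e d z] by (metis imageI)
    then show ?thesis
      using c cyc by (auto simp: bounding_on_def)
  qed
  have fin: "finite (shift d z ` S)" using assms by simp
  \<comment> \<open>Every chain is recovered from its pullback, so the translated space lies in a
    linear image of the original one, where \<open>dim_comp_le\<close> applies.\<close>
  have im: "A \<subseteq> (\<lambda>c. c \<circ> shift d (-z)) ` B" if "\<And>c. c \<in> A \<Longrightarrow> c \<circ> shift d z \<in> B" for A B :: "chain set"
    using that comp_shift_uminus[of _ d z] by (metis image_eqI subsetI)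
  have shS: "(\<lambda>c. c \<circ> shift d (-z)) ` V \<subseteq> chains_on (shift d z ` S)" if "V \<subseteq> chains_on S" for V
    using that by (force simp: chains_on_def image_iff shift_uminus_shift)
  have "fun_vs.dim (cycles_on d (shift d z ` S)) \<le> fun_vs.dim ((\<lambda>c. c \<circ> shift d (-z)) ` cycles_on d S)"
    by (intro dim_chains_on_mono[OF fin] shS cycles_on_subset im cyc)
  then show "fun_vs.dim (cycles_on d (shift d z ` S)) \<le> fun_vs.dim (cycles_on d S)"
    using dim_comp_le[OF assms(1) cycles_on_subset, of "shift d (-z)" d] by simp
  have "fun_vs.dim (bounding_on d (shift d z ` S) (shift d z ` T))
      \<le> fun_vs.dim ((\<lambda>c. c \<circ> shift d (-z)) ` bounding_on d S T)"
    by (intro dim_chains_on_mono[OF fin] shS bounding_on_subset im bnd)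
  then show "fun_vs.dim (bounding_on d (shift d z ` S) (shift d z ` T)) \<le> fun_vs.dim (bounding_on d S T)"
    using dim_comp_le[OF assms(1) bounding_on_subset, of "shift d (-z)" d T] by simp
qed

lemma betti_on_shift:
  assumes "finite S" "finite T"
  shows "betti_on d (shift d z ` S) (shift d z ` T) = betti_on d S T"
proof -
  have unshift: "shift d (-z) ` shift d z ` A = A" for A
    by (simp add: image_image shift_uminus_shift)
  show ?thesis
    unfolding betti_on_def
    using dim_shift_le[OF assms, of d z] dim_shift_le[of "shift d z ` S" "shift d z ` T" d "-z"] assms
    unfolding unshift by simp
qed

section \<open>Cubes in boxes\<close>

definition box_region :: "nat \<Rightarrow> (nat \<Rightarrow> int) \<Rightarrow> nat \<Rightarrow> point set" where
  "box_region d a k = {x \<in> Rd d. \<forall>i<d. real_of_int (a i) \<le> x i \<and> x i \<le> real_of_int (a i) + real k}"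

text \<open>The elementary intervals inside \<open>[a, a + k]\<close>: k+1 points and k unit
  intervals. This is the origin of the factor \<open>2 * k + 1\<close>.\<close>

definition box_ivals :: "int \<Rightarrow> nat \<Rightarrow> (int \<times> bool) set" where
  "box_ivals a k = {a..a + int k} \<times> {False} \<union> {a..<a + int k} \<times> {True}"

definition box_cubes :: "nat \<Rightarrow> (nat \<Rightarrow> int) \<Rightarrow> nat \<Rightarrow> ecube set" where
  "box_cubes d a k = {Q \<in> Kube d. \<forall>i<d. Q i \<in> box_ivals (a i) k}"

lemma Lam_eq_box_region: "Lam d n = box_region d (\<lambda>_. - int n) (2 * n)"
  by (auto simp: Lam_def box_region_def)

lemma cubes_in_box_region: "{Q \<in> Kube d. cell d Q \<subseteq> box_region d a k} = box_cubes d a k"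
proof (intro set_eqI iffI)
  fix Q assume "Q \<in> {Q \<in> Kube d. cell d Q \<subseteq> box_region d a k}"
  then have Q: "Q \<in> Kube d" "cell d Q \<subseteq> box_region d a k" by auto
  \<comment> \<open>The lowest and the highest corner of the cell already decide whether it fits
    into the box.\<close>
  define lo where "lo = (\<lambda>i. if i < d then real_of_int (fst (Q i)) else 0)"
  define hi where "hi = (\<lambda>i. if i < d then real_of_int (fst (Q i)) + (if snd (Q i) then 1 else 0) else 0)"
  have "lo \<in> cell d Q" "hi \<in> cell d Q"
    by (auto simp: cell_def lo_def hi_def Rd_def ival_def)
  then have "lo \<in> box_region d a k" "hi \<in> box_region d a k"
    using Q(2) by auto
  then have "a i \<le> fst (Q i) \<and> fst (Q i) + (if snd (Q i) then 1 else 0) \<le> a i + int k" if "i < d" for i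
    using that unfolding box_region_def lo_def hi_def
    by (auto split: if_splits)
  then have "Q i \<in> box_ivals (a i) k" if "i < d" for i
    using that by (cases "Q i") (force simp: box_ivals_def split: if_splits)
  then show "Q \<in> box_cubes d a k"
    using Q(1) by (auto simp: box_cubes_def)
next
  fix Q assume Q: "Q \<in> box_cubes d a k"
  have "x \<in> box_region d a k" if x: "x \<in> cell d Q" for x
  proof -
    have "real_of_int (a i) \<le> x i \<and> x i \<le> real_of_int (a i) + real k" if "i < d" for i
    proof -
      obtain l b where lb: "Q i = (l, b)" by (cases "Q i")
      have "x i \<in> ival (l, b)" using x that lb by (auto simp: cell_def)
      moreover have "(l, b) \<in> box_ivals (a i) k" using Q that lb by (auto simp: box_cubes_def)
      then have "a i \<le> l" "l + (if b then 1 else 0) \<le> a i + int k"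
        by (auto simp: box_ivals_def)
      then have "real_of_int (a i) \<le> real_of_int l"
        "real_of_int (l + (if b then 1 else 0)) \<le> real_of_int (a i + int k)"
        unfolding of_int_le_iff by auto
      ultimately show ?thesis
        by (auto simp: ival_def split: if_splits)
    qed
    then show ?thesis using x by (auto simp: box_region_def cell_def)
  qed
  then show "Q \<in> {Q \<in> Kube d. cell d Q \<subseteq> box_region d a k}"
    using Q by (auto simp: box_cubes_def)
qed

lemma finite_box_ivals: "finite (box_ivals a k)"
  by (simp add: box_ivals_def)

lemma card_box_ivals: "card (box_ivals a k) = 2 * k + 1"
  unfolding box_ivals_def by (subst card_Un_disjoint) (auto simp: card_cartesian_product)

text \<open>Cubes are padded with \<open>(0, False)\<close> beyond coordinate \<open>d\<close>,
  members of the product with \<open>undefined\<close>; the map exchanges the two conventions so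
  that products can be counted.\<close>

lemma bij_betw_box_cubes:
  "bij_betw (\<lambda>Q. restrict Q {..<d}) (box_cubes d a k) (\<Pi>\<^sub>E i\<in>{..<d}. box_ivals (a i) k)"
proof (rule bij_betw_byWitness[where f' = "\<lambda>g i. if i < d then g i else (0, False)"])
  show "\<forall>Q\<in>box_cubes d a k. (\<lambda>i. if i < d then restrict Q {..<d} i else (0, False)) = Q"
    by (auto simp: box_cubes_def Kube_def fun_eq_iff)
  show "\<forall>g\<in>\<Pi>\<^sub>E i\<in>{..<d}. box_ivals (a i) k. restrict (\<lambda>i. if i < d then g i else (0, False)) {..<d} = g"
    by (auto simp: fun_eq_iff PiE_def extensional_def)
  show "(\<lambda>Q. restrict Q {..<d}) ` box_cubes d a k \<subseteq> (\<Pi>\<^sub>E i\<in>{..<d}. box_ivals (a i) k)"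
    by (auto simp: box_cubes_def PiE_def extensional_def)
  show "(\<lambda>g i. if i < d then g i else (0, False)) ` (\<Pi>\<^sub>E i\<in>{..<d}. box_ivals (a i) k) \<subseteq> box_cubes d a k"
    by (intro image_subsetI) (simp add: box_cubes_def Kube_def PiE_iff)
qed

lemma finite_box_cubes: "finite (box_cubes d a k)"
  using bij_betw_finite[OF bij_betw_box_cubes, of d a k] by (simp add: finite_PiE finite_box_ivals)

lemma card_box_cubes: "card (box_cubes d a k) = (2 * k + 1) ^ d"
  using bij_betw_same_card[OF bij_betw_box_cubes, of d a k] by (simp add: card_PiE card_box_ivals)

lemma box_cubes_mono:
  assumes "\<And>i. i < d \<Longrightarrow> a' i \<le> a i" "\<And>i. i < d \<Longrightarrow> a i + int k \<le> a' i + int k'"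
  shows "box_cubes d a k \<subseteq> box_cubes d a' k'"
proof -
  have "box_ivals (a i) k \<subseteq> box_ivals (a' i) k'" if "i < d" for i
    using assms[OF that] by (auto simp: box_ivals_def)
  then show ?thesis by (auto simp: box_cubes_def)
qed

text \<open>A face replaces one unit interval by an endpoint, and both endpoints belong to the
  closed box.\<close>

lemma face_closed_box_cubes: "face_closed d (box_cubes d a k)"
  unfolding face_closed_def
proof (intro ballI allI impI)
  fix Q P assume Q: "Q \<in> box_cubes d a k" and "incid d Q P \<noteq> 0"
  then obtain i where i: "i < d" "snd (Q i)"
    "P = Q(i := (fst (Q i) + 1, False)) \<or> P = Q(i := (fst (Q i), False))"
    unfolding incid_def by (auto elim!: sum.not_neutral_contains_not_neutral split: if_splits)
  obtain l where l: "Q i = (l, True)" using i(2) by (cases "Q i") auto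
  have "(l, True) \<in> box_ivals (a i) k"
    using Q i(1) l by (auto simp: box_cubes_def)
  then have "(l, False) \<in> box_ivals (a i) k" "(l + 1, False) \<in> box_ivals (a i) k"
    by (auto simp: box_ivals_def)
  then show "P \<in> box_cubes d a k"
    using Q i l by (auto simp: box_cubes_def Kube_def)
qed

lemma shift_image_box_cubes: "shift d z ` box_cubes d a k = box_cubes d (\<lambda>i. z i + a i) k"
proof -
  have iv: "shift d z Q \<in> box_cubes d (\<lambda>i. z i + a i) k" if "Q \<in> box_cubes d a k" for z a Q
  proof -
    have "(z i + fst (Q i), snd (Q i)) \<in> box_ivals (z i + a i) k" if "i < d" for i
      using \<open>Q \<in> box_cubes d a k\<close> that by (cases "Q i") (force simp: box_ivals_def box_cubes_def)
    then show ?thesis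
      using that by (auto simp: box_cubes_def shift_def Kube_def)
  qed
  have "Q \<in> shift d z ` box_cubes d a k" if "Q \<in> box_cubes d (\<lambda>i. z i + a i) k" for Q
    using iv[OF that, of "-z"] shift_uminus_shift(2)[of d z Q] by (force simp: image_iff)
  then show ?thesis using iv by blast
qed

lemma cdim_shift: "cdim d (shift d z Q) = cdim d Q"
  by (auto simp: cdim_def shift_def intro!: arg_cong[where f = card])

section \<open>Betti numbers as functions of birth times\<close>

text \<open>Taking an arbitrary birth function as argument makes this a function on the product
  space of birth times, where stationarity and dependence are formulated.\<close>

definition betti_births :: "nat \<Rightarrow> nat \<Rightarrow> real \<Rightarrow> real \<Rightarrow> ecube set \<Rightarrow> (ecube \<Rightarrow> ereal) \<Rightarrow> real" where
  "betti_births d q s t K b = real (betti_on d {Q \<in> K. cdim d Q = q \<and> b Q \<le> ereal s}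
     {Q \<in> K. cdim d Q = Suc q \<and> b Q \<le> ereal t})"

text \<open>Right continuity of the filtration is what includes the borderline case in which the
  infimum equals \<open>t\<close>: the cell lies in \<open>X t'\<close> for every later
  \<open>t'\<close>, hence in their intersection.\<close>

lemma birth_le_iff:
  assumes "cubical_filtration d X" "0 \<le> t"
  shows "birth d X Q \<le> ereal t \<longleftrightarrow> cell d Q \<subseteq> X t"
proof
  assume le: "birth d X Q \<le> ereal t"
  have "cell d Q \<subseteq> X t'" if "t < t'" for t'
  proof -
    have "birth d X Q < ereal t'" using le that by (metis less_ereal.simps(1) order_le_less_trans)
    then obtain u where u: "0 \<le> u" "cell d Q \<subseteq> X u" "u < t'"
      unfolding birth_def Inf_less_iff by auto
    have mono: "\<forall>s t. 0 \<le> s \<longrightarrow> s \<le> t \<longrightarrow> X s \<subseteq> X t"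
      using assms(1) unfolding cubical_filtration_def by (elim conjE)
    have "X u \<subseteq> X t'" using mono u(1,3) by simp
    with u(2) show ?thesis by (rule order_trans)
  qed
  then have "cell d Q \<subseteq> (\<Inter>t'\<in>{t<..}. X t')" by auto
  also have "\<dots> = X t"
    using assms unfolding cubical_filtration_def by metis
  finally show "cell d Q \<subseteq> X t" .
next
  assume "cell d Q \<subseteq> X t"
  then show "birth d X Q \<le> ereal t"
    unfolding birth_def using assms(2) by (intro Inf_lower) auto
qed

lemma pers_betti_eq_betti_births:
  assumes "cubical_filtration d X" "0 \<le> s" "s \<le> t"
  shows "real (pers_betti d q (X s \<inter> Lam d n) (X t \<inter> Lam d n))
    = betti_births d q s t (box_cubes d (\<lambda>_. - int n) (2 * n)) (birth d X)"
proof -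
  have eq: "cubes_of d p (X u \<inter> Lam d n)
      = {Q \<in> box_cubes d (\<lambda>_. - int n) (2 * n). cdim d Q = p \<and> birth d X Q \<le> ereal u}" if "0 \<le> u" for p u
    unfolding cubes_of_def Lam_eq_box_region cubes_in_box_region[symmetric]
    using birth_le_iff[OF assms(1) that] by auto
  show ?thesis
    unfolding betti_births_def using assms(2,3) finite_box_cubes[of d]
    by (subst pers_betti_eq_betti_on) (auto simp: eq)
qed

lemma betti_births_Lipschitz:
  assumes "finite K'" "K \<subseteq> K'"
  shows "\<bar>betti_births d q s t K' b - betti_births d q s t K b\<bar> \<le> 2 * real (card (K' - K))"
proof -
  let ?S = "\<lambda>K. {Q \<in> K. cdim d Q = q \<and> b Q \<le> ereal s}"
  let ?T = "\<lambda>K. {Q \<in> K. cdim d Q = Suc q \<and> b Q \<le> ereal t}"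
  \<comment> \<open>Cubes of dimensions q and q+1 are distinct, so each added cube is counted at
    most once, with weight at most 2.\<close>
  have "card (?S K' - ?S K) + card (?T K' - ?T K) = card ((?S K' - ?S K) \<union> (?T K' - ?T K))"
    using assms by (intro card_Un_disjoint[symmetric]) auto
  also have "\<dots> \<le> card (K' - K)"
    using assms by (intro card_mono) auto
  finally have le: "card (?S K' - ?S K) + card (?T K' - ?T K) \<le> card (K' - K)" .
  have "\<bar>betti_births d q s t K' b - betti_births d q s t K b\<bar>
      \<le> 2 * real (card (?S K' - ?S K)) + real (card (?T K' - ?T K))"
    unfolding betti_births_def using assms by (intro betti_on_Lipschitz) auto
  with le show ?thesis by linarith
qed

lemma betti_births_empty: "betti_births d q s t {} b = 0"
proof -
  \<comment> \<open>Additivity for empty sets gives x = x + x.\<close>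
  have "betti_on d {} {} = 0"
    using betti_on_Un[of "{}" "{}" d "{}" "{}" "{}" "{}"] by (simp add: face_closed_def)
  then show ?thesis by (simp add: betti_births_def)
qed

lemma betti_births_nonneg: "0 \<le> betti_births d q s t K b"
  by (simp add: betti_births_def)

lemma betti_births_le:
  assumes "finite K"
  shows "betti_births d q s t K b \<le> 2 * real (card K)"
  using betti_births_Lipschitz[OF assms, of "{}" d q s t b] unfolding betti_births_empty by simp

lemma betti_births_Un:
  assumes "finite K1" "finite K2" "K1 \<inter> K2 = {}" "face_closed d K1" "face_closed d K2"
  shows "betti_births d q s t (K1 \<union> K2) b = betti_births d q s t K1 b + betti_births d q s t K2 b"
proof -
  have "{Q \<in> K1 \<union> K2. P Q} = {Q \<in> K1. P Q} \<union> {Q \<in> K2. P Q}" for P by auto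
  then show ?thesis
    unfolding betti_births_def by (simp only:) (subst betti_on_Un[OF assms], auto)
qed

lemma betti_births_UN:
  assumes "finite G" "\<And>z. z \<in> G \<Longrightarrow> finite (K z)" "\<And>z. z \<in> G \<Longrightarrow> face_closed d (K z)"
    "disjoint_family_on K G"
  shows "betti_births d q s t (\<Union>z\<in>G. K z) b = (\<Sum>z\<in>G. betti_births d q s t (K z) b)"
  using assms
proof (induction G rule: finite_induct)
  case empty
  then show ?case by (simp add: betti_births_empty)
next
  case (insert z G)
  have "face_closed d (\<Union>z\<in>G. K z)"
    using insert.prems(2) unfolding face_closed_def by blast
  moreover have "K z \<inter> K z' = {}" if "z' \<in> G" for z'
  proof -
    have "z \<noteq> z'" using that insert.hyps(2) by auto
    then show ?thesis using insert.prems(3) that by (simp add: disjoint_family_on_def)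
  qed
  then have "K z \<inter> (\<Union>z\<in>G. K z) = {}" by blast
  moreover have "disjoint_family_on K G"
    using insert.prems(3) by (auto simp: disjoint_family_on_def)
  ultimately show ?case
    using insert by (simp add: betti_births_Un)
qed

lemma betti_births_shift:
  assumes "finite K"
  shows "betti_births d q s t (shift d z ` K) b = betti_births d q s t K (\<lambda>Q. b (shift d z Q))"
proof -
  have eq: "{Q \<in> shift d z ` K. cdim d Q = p \<and> b Q \<le> u}
      = shift d z ` {Q \<in> K. cdim d Q = p \<and> b (shift d z Q) \<le> u}" for p u
    by (auto simp: cdim_shift)
  show ?thesis
    unfolding betti_births_def eq using assms by (subst betti_on_shift) auto
qed

lemma betti_births_cong:
  assumes "\<And>Q. Q \<in> K \<Longrightarrow> b Q = b' Q"
  shows "betti_births d q s t K b = betti_births d q s t K b'"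
proof -
  have "{Q \<in> K. P Q \<and> b Q \<le> u} = {Q \<in> K. P Q \<and> b' Q \<le> u}" for P u
    using assms by auto
  then show ?thesis by (simp add: betti_births_def)
qed

lemma measurable_Collect_finite:
  assumes "finite K" "\<And>Q. Q \<in> K \<Longrightarrow> Measurable.pred M (\<lambda>\<omega>. P \<omega> Q)"
  shows "(\<lambda>\<omega>. {Q \<in> K. P \<omega> Q}) \<in> M \<rightarrow>\<^sub>M count_space (Pow K)"
proof -
  have "(\<lambda>\<omega>. {Q \<in> K. P \<omega> Q}) -` {A} \<inter> space M \<in> sets M" if "A \<in> Pow K" for A
  proof -
    have "(\<lambda>\<omega>. {Q \<in> K. P \<omega> Q}) -` {A} \<inter> space M = {\<omega> \<in> space M. \<forall>Q\<in>K. P \<omega> Q = (Q \<in> A)}"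
      using that by auto
    also have "\<dots> \<in> sets M"
      using assms by (intro sets.sets_Collect_finite_All) auto
    finally show ?thesis .
  qed
  then show ?thesis
    using assms(1) by (auto simp: measurable_count_space_eq_countable uncountable_def countable_finite)
qed

text \<open>The value factors through two random subsets of the finite set \<open>K\<close>. Such a
  pair lives in a discrete space, on which every function is measurable.\<close>

lemma betti_births_measurable:
  assumes "finite K" "\<And>Q. Q \<in> K \<Longrightarrow> (\<lambda>\<omega>. b \<omega> Q) \<in> borel_measurable M"
  shows "(\<lambda>\<omega>. betti_births d q s t K (b \<omega>)) \<in> borel_measurable M"
proof -
  let ?S = "\<lambda>\<omega>. {Q \<in> K. cdim d Q = q \<and> b \<omega> Q \<le> ereal s}"
  let ?T = "\<lambda>\<omega>. {Q \<in> K. cdim d Q = Suc q \<and> b \<omega> Q \<le> ereal t}"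
  have S: "?S \<in> M \<rightarrow>\<^sub>M count_space (Pow K)" and T: "?T \<in> M \<rightarrow>\<^sub>M count_space (Pow K)"
    using assms by (auto intro!: measurable_Collect_finite)
  have "(\<lambda>\<omega>. (?S \<omega>, ?T \<omega>)) \<in> M \<rightarrow>\<^sub>M count_space (Pow K) \<Otimes>\<^sub>M count_space (Pow K)"
    using S T by (rule measurable_Pair)
  also have "count_space (Pow K) \<Otimes>\<^sub>M count_space (Pow K) = count_space (Pow K \<times> Pow K)"
    using assms(1) by (intro pair_measure_count_space) auto
  finally have "(\<lambda>\<omega>. (?S \<omega>, ?T \<omega>)) \<in> M \<rightarrow>\<^sub>M count_space (Pow K \<times> Pow K)" .
  then have "(\<lambda>\<omega>. (\<lambda>(A, B). real (betti_on d A B)) (?S \<omega>, ?T \<omega>)) \<in> borel_measurable M"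
    by (rule measurable_compose) simp
  then show ?thesis by (simp add: betti_births_def)
qed

section \<open>Blocks of a stationary finite-range filtration\<close>

text \<open>The sum of the squares has finite integral, so it is finite almost everywhere and its
  terms tend to 0.\<close>

lemma AE_tendsto_0_if_summable_integral_square:
  fixes f :: "nat \<Rightarrow> 'a \<Rightarrow> real"
  assumes int: "\<And>j. integrable M (\<lambda>\<omega>. (f j \<omega>)\<^sup>2)"
    and sm: "summable (\<lambda>j. \<integral>\<omega>. (f j \<omega>)\<^sup>2 \<partial>M)"
  shows "AE \<omega> in M. (\<lambda>j. f j \<omega>) \<longlonglongrightarrow> 0"
proof -
  have meas[measurable]: "(\<lambda>\<omega>. (f j \<omega>)\<^sup>2) \<in> borel_measurable M" for j
    using int by (rule borel_measurable_integrable)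
  have "(\<integral>\<^sup>+\<omega>. (\<Sum>j. ennreal ((f j \<omega>)\<^sup>2)) \<partial>M) = (\<Sum>j. \<integral>\<^sup>+\<omega>. ennreal ((f j \<omega>)\<^sup>2) \<partial>M)"
    by (intro nn_integral_suminf) simp
  also have "\<dots> = (\<Sum>j. ennreal (\<integral>\<omega>. (f j \<omega>)\<^sup>2 \<partial>M))"
    using int by (subst nn_integral_eq_integral) auto
  also have "\<dots> \<noteq> \<infinity>"
    using sm by (subst suminf_ennreal2) auto
  finally have "AE \<omega> in M. (\<Sum>j. ennreal ((f j \<omega>)\<^sup>2)) \<noteq> \<infinity>"
    by (intro nn_integral_PInf_AE) auto
  then show ?thesis
  proof eventually_elim
    case (elim \<omega>)
    then have "summable (\<lambda>j. (f j \<omega>)\<^sup>2)"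
      by (intro summable_suminf_not_top) auto
    then have "(\<lambda>j. (f j \<omega>)\<^sup>2) \<longlonglongrightarrow> 0"
      by (rule summable_LIMSEQ_zero)
    then have "(\<lambda>j. sqrt ((f j \<omega>)\<^sup>2)) \<longlonglongrightarrow> sqrt 0"
      by (rule tendsto_real_sqrt)
    then show ?case by (simp add: tendsto_rabs_zero_iff)
  qed
qed

text \<open>Indices of blocks are extensional functions, so that distinct ones differ in a
  coordinate that the geometry sees.\<close>

lemma extensional_lessThan_neqE:
  assumes "z \<in> extensional {..<d}" "z' \<in> extensional {..<d}" "z \<noteq> z'"
  obtains i where "i < d" "z i \<noteq> z' i"
proof -
  have "\<not> (\<forall>i<d. z i = z' i)"
    using assms extensionalityI[OF assms(1,2)] by auto
  then show thesis using that by blast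
qed

locale stationary_dependent_filtration = prob_space M for M :: "'w measure" +
  fixes d :: nat and X :: "'w \<Rightarrow> real \<Rightarrow> point set" and R q :: nat and s t :: real
  assumes filtration: "random_cubical_filtration d M X"
    and stat: "stationary d M X"
    and dep: "R_dependent d M (real R) X"
    and d_pos: "0 < d"
begin

definition betti :: "ecube set \<Rightarrow> 'w \<Rightarrow> real" where
  "betti K \<omega> = betti_births d q s t K (birth d (X \<omega>))"

text \<open>A gap of \<open>R + 1\<close> rather than \<open>R\<close> gives a distance strictly
  above \<open>R\<close>, and keeps blocks disjoint when \<open>R = 0\<close>.\<close>

definition period :: "nat \<Rightarrow> nat" where
  "period k = k + R + 1"

definition block :: "nat \<Rightarrow> (nat \<Rightarrow> int) \<Rightarrow> ecube set" where
  "block k z = box_cubes d (\<lambda>i. int (period k) * z i) k"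

text \<open>The range is half open because a block extends to the right of its base point; the last
  index \<open>m - 1\<close> still leaves room for a whole period.\<close>

definition grid :: "nat \<Rightarrow> (nat \<Rightarrow> int) set" where
  "grid m = (\<Pi>\<^sub>E i\<in>{..<d}. {- int m..<int m})"

lemma birth_measurable: "Q \<in> Kube d \<Longrightarrow> (\<lambda>\<omega>. birth d (X \<omega>) Q) \<in> borel_measurable M"
  using filtration by (auto simp: random_cubical_filtration_def)

lemma box_cubes_Kube: "box_cubes d a k \<subseteq> Kube d"
  by (auto simp: box_cubes_def)

lemma block_Kube: "block k z \<subseteq> Kube d"
  by (auto simp: block_def box_cubes_def)

lemma finite_block: "finite (block k z)"
  by (simp add: block_def finite_box_cubes)

lemma face_closed_block: "face_closed d (block k z)"
  by (simp add: block_def face_closed_box_cubes)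

lemma betti_measurable: "finite K \<Longrightarrow> K \<subseteq> Kube d \<Longrightarrow> betti K \<in> borel_measurable M"
  unfolding betti_def by (intro betti_births_measurable birth_measurable) auto

lemma abs_betti_le: "finite K \<Longrightarrow> \<bar>betti K \<omega>\<bar> \<le> 2 * real (card K)"
  unfolding betti_def using betti_births_nonneg betti_births_le by auto

lemma betti_integrable: "finite K \<Longrightarrow> K \<subseteq> Kube d \<Longrightarrow> integrable M (betti K)"
  using abs_betti_le betti_measurable
  by (intro integrable_const_bound[where B = "2 * real (card K)"]) auto

section \<open>Moments of the block values\<close>

lemma expectation_block: "expectation (betti (block k z)) = expectation (betti (block k (\<lambda>_. 0)))"
proof -
  define w where "w = (\<lambda>i. int (period k) * z i)"
  define N where "N = (\<Pi>\<^sub>M Q\<in>Kube d. (borel :: ereal measure))"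
  define h where "h = betti_births d q s t (block k (\<lambda>_. 0))"
  have h: "h \<in> borel_measurable N"
    unfolding h_def N_def using block_Kube
    by (intro betti_births_measurable[OF finite_block] measurable_component_singleton) auto
  have shift_Kube: "shift d w Q \<in> Kube d" if "Q \<in> Kube d" for Q
    using that by (auto simp: Kube_def shift_def)
  have m0: "births_on d X (Kube d) \<in> M \<rightarrow>\<^sub>M N"
    unfolding N_def births_on_def by (intro measurable_restrict birth_measurable)
  have m1: "(\<lambda>\<omega>. \<lambda>Q\<in>Kube d. birth d (X \<omega>) (shift d w Q)) \<in> M \<rightarrow>\<^sub>M N"
    unfolding N_def by (intro measurable_restrict birth_measurable shift_Kube)
  have blk: "block k z = shift d w ` block k (\<lambda>_. 0)"
    unfolding block_def w_def shift_image_box_cubes by simp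
  \<comment> \<open>Translating the block to the origin moves the shift into the birth times. Both
    expectations then integrate the same \<open>h\<close>, against two laws that stationarity
    equates.\<close>
  have fn: "betti (block k z) = (\<lambda>\<omega>. h (\<lambda>Q\<in>Kube d. birth d (X \<omega>) (shift d w Q)))"
    unfolding betti_def blk betti_births_shift[OF finite_block] h_def
    using block_Kube by (intro ext betti_births_cong) auto
  have "expectation (betti (block k z))
      = expectation (\<lambda>\<omega>. h (\<lambda>Q\<in>Kube d. birth d (X \<omega>) (shift d w Q)))"
    by (simp only: fn)
  also have "\<dots> = integral\<^sup>L (distr M N (\<lambda>\<omega>. \<lambda>Q\<in>Kube d. birth d (X \<omega>) (shift d w Q))) h"
    by (rule integral_distr[OF m1 h, symmetric])
  also have "distr M N (\<lambda>\<omega>. \<lambda>Q\<in>Kube d. birth d (X \<omega>) (shift d w Q)) = distr M N (births_on d X (Kube d))"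
    using stat unfolding stationary_def N_def by metis
  also have "integral\<^sup>L \<dots> h = expectation (\<lambda>\<omega>. h (births_on d X (Kube d) \<omega>))"
    by (rule integral_distr[OF m0 h])
  also have "(\<lambda>\<omega>. h (births_on d X (Kube d) \<omega>)) = betti (block k (\<lambda>_. 0))"
    unfolding betti_def h_def births_on_def using block_Kube by (intro ext betti_births_cong) auto
  finally show ?thesis .
qed

lemma setdist_max_block_regions:
  assumes "i < d" "z i \<noteq> z' i"
  shows "setdist_max d (box_region d (\<lambda>i. int (period k) * z i) k) (box_region d (\<lambda>i. int (period k) * z' i) k)
    > ereal (real R)"
proof -
  \<comment> \<open>The left block ends \<open>k\<close> after its base point and the right one
    starts at least a full period after that point. One coordinate suffices in the maximum
    norm.\<close>
  have sep: "real R + 1 \<le> \<bar>u - v\<bar>"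
    if z: "z < z'" and u: "real_of_int (int (period k) * z) \<le> u" "u \<le> real_of_int (int (period k) * z) + real k"
      and v: "real_of_int (int (period k) * z') \<le> v" for z z' :: int and u v :: real
  proof -
    have "int (period k) * (z + 1) \<le> int (period k) * z'"
      using z by (intro mult_left_mono) auto
    then have "real_of_int (int (period k) * (z + 1)) \<le> real_of_int (int (period k) * z')"
      by (simp only: of_int_le_iff)
    then have "real_of_int (int (period k) * z) + real (period k) \<le> real_of_int (int (period k) * z')"
      by (simp add: algebra_simps)
    then have "real R + 1 \<le> v - u"
      using u v by (simp add: period_def)
    then show ?thesis by linarith
  qed
  have "real R + 1 \<le> maxdist d x y"
    if x: "x \<in> box_region d (\<lambda>i. int (period k) * z i) k"
      and y: "y \<in> box_region d (\<lambda>i. int (period k) * z' i) k" for x y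
  proof -
    have "real R + 1 \<le> \<bar>x i - y i\<bar>"
    proof (cases "z i < z' i")
      case True
      then show ?thesis using sep[OF True, of "x i" "y i"] x y assms(1) by (auto simp: box_region_def)
    next
      case False
      then have "z' i < z i" using assms(2) by simp
      from sep[OF this, of "y i" "x i"] show ?thesis
        using x y assms(1) by (auto simp: box_region_def abs_minus_commute)
    qed
    also have "\<dots> \<le> maxdist d x y"
      unfolding maxdist_def using assms(1) by (intro Max_ge) auto
    finally show ?thesis .
  qed
  \<comment> \<open>The uniform bound \<open>R + 1\<close> survives the infimum, which pointwise
    strict inequalities would not.\<close>
  then have "ereal (real R + 1) \<le> setdist_max d (box_region d (\<lambda>i. int (period k) * z i) k)
      (box_region d (\<lambda>i. int (period k) * z' i) k)"
    unfolding setdist_max_def by (intro INF_greatest) simp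
  then show ?thesis
    by (rule less_le_trans[rotated]) simp
qed

text \<open>The cubes contained in a box region are exactly those of the block, so the dependence
  hypothesis applies to the birth times from which the block values are computed.\<close>

lemma indep_blocks:
  assumes "i < d" "z i \<noteq> z' i"
  shows "indep_var borel (betti (block k z)) borel (betti (block k z'))"
proof -
  have eq: "betti (block k z) = betti_births d q s t (block k z) \<circ> births_on d X (block k z)" for z
    unfolding betti_def births_on_def by (intro ext) (auto intro!: betti_births_cong)
  have h: "betti_births d q s t (block k z) \<in> borel_measurable (\<Pi>\<^sub>M Q\<in>block k z. borel)" for z
    by (intro betti_births_measurable[OF finite_block] measurable_component_singleton)
  have sub: "box_region d a k \<subseteq> Rd d" for a
    by (auto simp: box_region_def)
  have "indep_var (\<Pi>\<^sub>M Q\<in>block k z. borel) (births_on d X (block k z))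
      (\<Pi>\<^sub>M Q\<in>block k z'. borel) (births_on d X (block k z'))"
    using dep setdist_max_block_regions[of i z z', OF assms, of k] sub
    unfolding R_dependent_def block_def cubes_in_box_region[symmetric] Let_def by blast
  then show ?thesis
    unfolding eq by (rule indep_var_compose[OF _ h h])
qed

text \<open>Stationarity lets one constant centre all blocks. Pairwise independence then kills the
  off-diagonal terms of the squared sum, leaving \<open>card G\<close> bounded ones.\<close>

lemma variance_blocks:
  fixes k :: nat
  assumes G: "finite G" "G \<subseteq> extensional {..<d}"
  defines "U \<equiv> \<lambda>z \<omega>. betti (block k z) \<omega> - expectation (betti (block k (\<lambda>_. 0)))"
  shows "integrable M (\<lambda>\<omega>. (\<Sum>z\<in>G. U z \<omega>)\<^sup>2)"
    and "expectation (\<lambda>\<omega>. (\<Sum>z\<in>G. U z \<omega>)\<^sup>2) \<le> real (card G) * (4 * (2 * real k + 1) ^ d)\<^sup>2"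
proof -
  \<comment> \<open>Twice the number of cubes bounds a block value, by comparison with the empty
    set; centring doubles the bound to \<open>2 * C\<close>.\<close>
  define C where "C = 2 * (2 * real k + 1) ^ d"
  have C0: "0 \<le> C" by (simp add: C_def)
  have b: "\<bar>betti (block k z) \<omega>\<bar> \<le> C" for z \<omega>
    using abs_betti_le[OF finite_block, of k z \<omega>]
    by (simp add: block_def card_box_cubes C_def add.commute)
  have int: "integrable M (betti (block k z))" for z
    by (rule betti_integrable[OF finite_block block_Kube])
  have "\<bar>expectation (betti (block k (\<lambda>_. 0)))\<bar> \<le> expectation (\<lambda>\<omega>. \<bar>betti (block k (\<lambda>_. 0)) \<omega>\<bar>)"
    by (rule integral_abs_bound)
  also have "\<dots> \<le> C"
    using b int by (intro integral_le_const) auto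
  finally have mu: "\<bar>expectation (betti (block k (\<lambda>_. 0)))\<bar> \<le> C" .
  have Ub: "\<bar>U z \<omega>\<bar> \<le> 2 * C" for z \<omega>
    using b[of z \<omega>] mu unfolding U_def by linarith
  have Um[measurable]: "U z \<in> borel_measurable M" for z
    unfolding U_def using betti_measurable[OF finite_block block_Kube] by measurable
  have Uint: "integrable M (U z)" for z
    unfolding U_def using int by simp
  have UU: "\<bar>U z \<omega> * U z' \<omega>\<bar> \<le> (2 * C)\<^sup>2" for z z' \<omega>
    unfolding abs_mult power2_eq_square using Ub C0 by (intro mult_mono) auto
  have UUint: "integrable M (\<lambda>\<omega>. U z \<omega> * U z' \<omega>)" for z z'
    using UU by (intro integrable_const_bound[where B = "(2 * C)\<^sup>2"]) auto
  have EU: "expectation (U z) = 0" for z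
    unfolding U_def using int by (simp add: expectation_block[of k z] prob_space)
  have cov: "expectation (\<lambda>\<omega>. U z \<omega> * U z' \<omega>) = 0" if zz: "z \<in> G" "z' \<in> G" "z \<noteq> z'" for z z'
  proof -
    obtain i where i: "i < d" "z i \<noteq> z' i"
      using zz G(2) extensional_lessThan_neqE[of z d z'] by blast
    have "indep_var borel ((\<lambda>x. x - expectation (betti (block k (\<lambda>_. 0)))) \<circ> betti (block k z))
        borel ((\<lambda>x. x - expectation (betti (block k (\<lambda>_. 0)))) \<circ> betti (block k z'))"
      by (rule indep_var_compose[OF indep_blocks[of i z z', OF i]]) simp_all
    then have "indep_var borel (U z) borel (U z')"
      by (simp add: U_def comp_def)
    from indep_var_lebesgue_integral[OF this Uint Uint] EU show ?thesis by simp
  qed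
  have sq: "(\<Sum>z\<in>G. U z \<omega>)\<^sup>2 = (\<Sum>z\<in>G. \<Sum>z'\<in>G. U z \<omega> * U z' \<omega>)" for \<omega>
    by (simp add: power2_eq_square sum_product)
  show "integrable M (\<lambda>\<omega>. (\<Sum>z\<in>G. U z \<omega>)\<^sup>2)"
    unfolding sq using UUint by simp
  have "expectation (\<lambda>\<omega>. (\<Sum>z\<in>G. U z \<omega>)\<^sup>2)
      = (\<Sum>z\<in>G. \<Sum>z'\<in>G. expectation (\<lambda>\<omega>. U z \<omega> * U z' \<omega>))"
    unfolding sq using UUint by (simp add: Bochner_Integration.integral_sum)
  also have "\<dots> = (\<Sum>z\<in>G. \<Sum>z'\<in>G. if z' = z then expectation (\<lambda>\<omega>. U z \<omega> * U z \<omega>) else 0)"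
    using cov by (intro sum.cong refl) auto
  also have "\<dots> = (\<Sum>z\<in>G. expectation (\<lambda>\<omega>. U z \<omega> * U z \<omega>))"
    using G(1) by simp
  also have "\<dots> \<le> (\<Sum>z\<in>G. (2 * C)\<^sup>2)"
    using UU UUint by (intro sum_mono integral_le_const) (auto simp: abs_le_iff)
  also have "\<dots> = real (card G) * (4 * (2 * real k + 1) ^ d)\<^sup>2"
    by (simp add: C_def)
  finally show "expectation (\<lambda>\<omega>. (\<Sum>z\<in>G. U z \<omega>)\<^sup>2) \<le> real (card G) * (4 * (2 * real k + 1) ^ d)\<^sup>2" .
qed

section \<open>Windows compared with the blocks they contain\<close>

lemma finite_grid: "finite (grid m)"
  by (simp add: grid_def finite_PiE)

lemma card_grid: "card (grid m) = (2 * m) ^ d"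
proof -
  have "card {- int m..<int m} = 2 * m" by simp
  then show ?thesis by (simp add: grid_def card_PiE del: card_atLeastLessThan_int)
qed

lemma grid_extensional: "grid m \<subseteq> extensional {..<d}"
  by (auto simp: grid_def PiE_def)

lemma disjoint_blocks: "disjoint_family_on (block k) (grid m)"
  unfolding disjoint_family_on_def
proof (intro ballI impI)
  fix z z' assume z: "z \<in> grid m" "z' \<in> grid m" "z \<noteq> z'"
  then obtain i where i: "i < d" "z i \<noteq> z' i"
    using grid_extensional[of m] extensional_lessThan_neqE[of z d z'] by blast
  have "box_ivals (int (period k) * u) k \<inter> box_ivals (int (period k) * v) k = {}"
    if "u < v" for u v :: int
  proof -
    have "int (period k) * (u + 1) \<le> int (period k) * v"
      using that by (intro mult_left_mono) auto
    then have "int (period k) * u + int k < int (period k) * v"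
      by (simp add: algebra_simps period_def)
    then show ?thesis by (auto simp: box_ivals_def)
  qed
  then have "box_ivals (int (period k) * z i) k \<inter> box_ivals (int (period k) * z' i) k = {}"
    using i(2) by (metis Int_commute linorder_neqE)
  then show "block k z \<inter> block k z' = {}"
    using i(1) by (auto simp: block_def box_cubes_def)
qed

abbreviation window :: "nat \<Rightarrow> ecube set" where
  "window n \<equiv> box_cubes d (\<lambda>_. - int n) (2 * n)"

lemma block_subset_window:
  assumes "z \<in> grid m" "period k * m \<le> n"
  shows "block k z \<subseteq> window n"
  unfolding block_def
proof (rule box_cubes_mono)
  fix i assume "i < d"
  then have z: "- int m \<le> z i" "z i + 1 \<le> int m"
    using assms(1) by (force simp: grid_def PiE_iff)+
  have n: "int (period k) * int m \<le> int n"
    using assms(2) by (metis of_nat_le_iff of_nat_mult)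
  have "int (period k) * (- int m) \<le> int (period k) * z i"
    using z by (intro mult_left_mono) auto
  then show "- int n \<le> int (period k) * z i" using n by simp
  have "int (period k) * (z i + 1) \<le> int (period k) * int m"
    using z by (intro mult_left_mono) auto
  then have "int (period k) * z i + int (period k) \<le> int n"
    using n by (simp add: algebra_simps)
  then show "int (period k) * z i + int k \<le> - int n + int (2 * n)"
    by (simp add: period_def)
qed

text \<open>The quotient is the largest \<open>m\<close> for which the whole grid of periods fits
  into the window. The bound is twice the number of cubes outside the blocks: the window has side
  \<open>2 * n\<close>, and there are \<open>(2 * m) ^ d\<close> blocks of
  \<open>(2 * k + 1) ^ d\<close> cubes each.\<close>

lemma betti_window_blocks:
  fixes k n :: nat
  defines "m \<equiv> \<lambda>k n. n div period k"
  shows "\<bar>betti (window n) \<omega> - (\<Sum>z\<in>grid (m k n). betti (block k z) \<omega>)\<bar>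
    \<le> 2 * ((4 * real n + 1) ^ d - (2 * real (m k n) * (2 * real k + 1)) ^ d)"
proof -
  define B where "B = (\<Union>z\<in>grid (m k n). block k z)"
  have sub: "B \<subseteq> window n"
    unfolding B_def m_def by (intro UN_least block_subset_window) auto
  have "card B = (\<Sum>z\<in>grid (m k n). card (block k z))"
    unfolding B_def using finite_grid finite_block disjoint_blocks
    by (intro card_UN_disjoint) (auto simp: disjoint_family_on_def)
  also have "\<dots> = (2 * m k n) ^ d * (2 * k + 1) ^ d"
    by (simp add: block_def card_box_cubes card_grid)
  also have "\<dots> = (2 * m k n * (2 * k + 1)) ^ d"
    by (simp only: power_mult_distrib)
  finally have cardB: "card B = (2 * m k n * (2 * k + 1)) ^ d" .
  have "real (card (window n - B)) = real (card (window n)) - real (card B)"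
    using card_Diff_subset[OF finite_subset[OF sub finite_box_cubes] sub]
      card_mono[OF finite_box_cubes sub] by (simp add: of_nat_diff)
  also have "\<dots> = (4 * real n + 1) ^ d - (2 * real (m k n) * (2 * real k + 1)) ^ d"
    by (simp add: cardB card_box_cubes algebra_simps)
  finally have card: "real (card (window n - B)) = (4 * real n + 1) ^ d - (2 * real (m k n) * (2 * real k + 1)) ^ d" .
  have "betti B \<omega> = (\<Sum>z\<in>grid (m k n). betti (block k z) \<omega>)"
    unfolding betti_def B_def using finite_grid finite_block disjoint_blocks
    by (intro betti_births_UN) (auto intro: face_closed_block)
  moreover have "\<bar>betti (window n) \<omega> - betti B \<omega>\<bar> \<le> 2 * real (card (window n - B))"
    unfolding betti_def by (rule betti_births_Lipschitz[OF finite_box_cubes sub])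
  ultimately show ?thesis using card by simp
qed

lemma betti_window_mono:
  assumes "n' \<le> n"
  shows "\<bar>betti (window n) \<omega> - betti (window n') \<omega>\<bar> \<le> 2 * ((4 * real n + 1) ^ d - (4 * real n' + 1) ^ d)"
proof -
  have sub: "window n' \<subseteq> window n"
    using assms by (intro box_cubes_mono) auto
  have "real (card (window n - window n')) = real (card (window n)) - real (card (window n'))"
    using card_Diff_subset[OF finite_box_cubes sub] card_mono[OF finite_box_cubes sub]
    by (simp add: of_nat_diff)
  also have "\<dots> = (4 * real n + 1) ^ d - (4 * real n' + 1) ^ d"
    by (simp add: card_box_cubes add.commute)
  finally show ?thesis
    unfolding betti_def using betti_births_Lipschitz[OF finite_box_cubes sub, of d q s t] by metis
qed

end

lemma div_nat_over_tendsto: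
  assumes "0 < L"
  shows "(\<lambda>n. real (n div L) / real n) \<longlonglongrightarrow> 1 / real L"
proof -
  have "(\<lambda>n. real (nat \<lfloor>real n / real L\<rfloor>) / real n) \<longlonglongrightarrow> inverse (real L)"
    using assms by real_asymp
  then show ?thesis
    by (simp add: floor_divide_of_nat_eq inverse_eq_divide)
qed

text \<open>The approximating value may change with \<open>e\<close>, so the limits obtained from
  different block sizes need not be compared.\<close>

lemma convergent_if_approximable:
  fixes x :: "nat \<Rightarrow> real"
  assumes "\<And>e. 0 < e \<Longrightarrow> \<exists>a. \<forall>\<^sub>F n in sequentially. \<bar>x n - a\<bar> < e"
  shows "convergent x"
proof -
  have "Cauchy x"
  proof (rule metric_CauchyI)
    fix e :: real assume "0 < e"
    then obtain a where "\<forall>\<^sub>F n in sequentially. \<bar>x n - a\<bar> < e / 2"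
      using assms[of "e / 2"] by auto
    then obtain N where N: "\<And>n. n \<ge> N \<Longrightarrow> \<bar>x n - a\<bar> < e / 2"
      by (auto simp: eventually_sequentially)
    have "dist (x m) (x n) < e" if "m \<ge> N" "n \<ge> N" for m n
      using N[OF that(1)] N[OF that(2)] unfolding dist_real_def by linarith
    then show "\<exists>N. \<forall>m\<ge>N. \<forall>n\<ge>N. dist (x m) (x n) < e" by blast
  qed
  then show ?thesis by (simp add: Cauchy_convergent_iff)
qed

section \<open>Convergence of the densities\<close>

context stationary_dependent_filtration
begin

definition block_error :: "nat \<Rightarrow> nat \<Rightarrow> real" where
  "block_error k n = 2 * ((4 * real n + 1) ^ d - (2 * real (n div period k) * (2 * real k + 1)) ^ d) / (2 * real n) ^ d"

definition block_mean :: "nat \<Rightarrow> real" where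
  "block_mean k = expectation (betti (block k (\<lambda>_. 0)))"

definition block_sum :: "nat \<Rightarrow> nat \<Rightarrow> 'w \<Rightarrow> real" where
  "block_sum k n \<omega> = (\<Sum>z\<in>grid (n div period k). betti (block k z) \<omega>)"

text \<open>Here \<open>2 ^ d\<close> is the asymptotic number of cubes per unit volume of the
  window, and the subtracted power is the number in one block per volume of its lattice
  cell.\<close>

lemma block_error_tendsto:
  "(\<lambda>n. block_error k n) \<longlonglongrightarrow> 2 * (2 ^ d - ((2 * real k + 1) / real (period k)) ^ d)"
proof -
  have "(\<lambda>n. 2 * (((4 * real n + 1) / (2 * real n)) ^ d
      - (real (n div period k) / real n * (2 * real k + 1)) ^ d))
    \<longlonglongrightarrow> 2 * (2 ^ d - (1 / real (period k) * (2 * real k + 1)) ^ d)"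
  proof (intro tendsto_mult tendsto_diff tendsto_power tendsto_const)
    show "(\<lambda>n. (4 * real n + 1) / (2 * real n)) \<longlonglongrightarrow> 2" by real_asymp
    show "(\<lambda>n. real (n div period k) / real n) \<longlonglongrightarrow> 1 / real (period k)"
      by (rule div_nat_over_tendsto) (simp add: period_def)
  qed
  moreover have "2 * (((4 * real n + 1) / (2 * real n)) ^ d
      - (real (n div period k) / real n * (2 * real k + 1)) ^ d) = block_error k n" for n
  proof -
    have "real (n div period k) / real n * (2 * real k + 1)
        = 2 * real (n div period k) * (2 * real k + 1) / (2 * real n)"
      by simp
    then show ?thesis
      unfolding block_error_def by (simp only: power_divide diff_divide_distrib[symmetric] times_divide_eq_right)
  qed
  ultimately show ?thesis by simp
qed

lemma block_error_small:
  assumes "0 < e"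
  obtains k where "\<forall>\<^sub>F n in sequentially. block_error k n < e"
proof -
  have "(\<lambda>k. (2 * real k + 1) / real (period k)) \<longlonglongrightarrow> 2"
    unfolding period_def by real_asymp
  then have "(\<lambda>k. 2 * (2 ^ d - ((2 * real k + 1) / real (period k)) ^ d)) \<longlonglongrightarrow> 2 * (2 ^ d - 2 ^ d)"
    by (intro tendsto_intros)
  then have "\<forall>\<^sub>F k in sequentially. 2 * (2 ^ d - ((2 * real k + 1) / real (period k)) ^ d) < e"
    using assms by (intro order_tendstoD(2)) auto
  then obtain k where "2 * (2 ^ d - ((2 * real k + 1) / real (period k)) ^ d) < e"
    by (auto simp: eventually_sequentially)
  then have "\<forall>\<^sub>F n in sequentially. block_error k n < e"
    by (rule order_tendstoD(2)[OF block_error_tendsto])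
  then show thesis by (rule that)
qed

lemma window_block_sum_diff:
  "\<bar>betti (window n) \<omega> - block_sum k n \<omega>\<bar> / (2 * real n) ^ d \<le> block_error k n"
  unfolding block_sum_def block_error_def
  using betti_window_blocks[of n \<omega> k] by (intro divide_right_mono) auto

lemma block_sum_integrable: "integrable M (block_sum k n)"
  unfolding block_sum_def
  using betti_integrable[OF finite_block block_Kube] by simp

lemma window_integrable: "integrable M (betti (window n))"
  by (rule betti_integrable[OF finite_box_cubes box_cubes_Kube])

lemma expectation_block_sum: "expectation (block_sum k n) = (2 * real (n div period k)) ^ d * block_mean k"
proof -
  have "expectation (block_sum k n) = (\<Sum>z\<in>grid (n div period k). expectation (betti (block k z)))"
    unfolding block_sum_def
    using betti_integrable[OF finite_block block_Kube] by (intro Bochner_Integration.integral_sum)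
  also have "\<dots> = (\<Sum>z\<in>grid (n div period k). block_mean k)"
    unfolding block_mean_def by (intro sum.cong refl expectation_block)
  also have "\<dots> = (2 * real (n div period k)) ^ d * block_mean k"
    by (simp add: card_grid)
  finally show ?thesis .
qed

lemma expectation_window_diff:
  "\<bar>expectation (betti (window n)) - expectation (block_sum k n)\<bar> / (2 * real n) ^ d \<le> block_error k n"
proof -
  have "\<bar>expectation (\<lambda>\<omega>. betti (window n) \<omega> - block_sum k n \<omega>)\<bar>
      \<le> expectation (\<lambda>\<omega>. \<bar>betti (window n) \<omega> - block_sum k n \<omega>\<bar>)"
    by (rule integral_abs_bound)
  also have "\<dots> \<le> 2 * ((4 * real n + 1) ^ d - (2 * real (n div period k) * (2 * real k + 1)) ^ d)"
    using betti_window_blocks[of n _ k, folded block_sum_def] window_integrable block_sum_integrable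
    by (intro integral_le_const) auto
  finally show ?thesis
    unfolding block_error_def using window_integrable block_sum_integrable
    by (intro divide_right_mono) auto
qed

section \<open>Limit of the mean densities\<close>

lemma convergent_expectation: "convergent (\<lambda>n. expectation (betti (window n)) / (2 * real n) ^ d)"
proof (rule convergent_if_approximable)
  fix e :: real assume e: "0 < e"
  obtain k where k: "\<forall>\<^sub>F n in sequentially. block_error k n < e / 2"
    using block_error_small[of "e / 2"] e by auto
  \<comment> \<open>For fixed \<open>k\<close> this is the limiting density of the block means; half
    of \<open>e\<close> pays for this limit and half for the discarded cubes.\<close>
  let ?a = "(1 / real (period k)) ^ d * block_mean k"
  have "(\<lambda>n. (real (n div period k) / real n) ^ d * block_mean k) \<longlonglongrightarrow> ?a"
    by (intro tendsto_mult tendsto_power tendsto_const div_nat_over_tendsto) (simp add: period_def)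
  from tendstoD[OF this, of "e / 2"] have "\<forall>\<^sub>F n in sequentially. \<bar>(real (n div period k) / real n) ^ d * block_mean k - ?a\<bar> < e / 2"
    using e unfolding dist_real_def by simp
  with k have "\<forall>\<^sub>F n in sequentially. \<bar>expectation (betti (window n)) / (2 * real n) ^ d - ?a\<bar> < e"
  proof eventually_elim
    case (elim n)
    have "expectation (block_sum k n) / (2 * real n) ^ d = (2 * real (n div period k) / (2 * real n)) ^ d * block_mean k"
      unfolding expectation_block_sum by (simp only: power_divide times_divide_eq_left)
    then have "expectation (block_sum k n) / (2 * real n) ^ d = (real (n div period k) / real n) ^ d * block_mean k"
      by simp
    moreover have "\<bar>expectation (betti (window n)) / (2 * real n) ^ d - expectation (block_sum k n) / (2 * real n) ^ d\<bar>
        \<le> block_error k n"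
      using expectation_window_diff[of n k] by (simp add: diff_divide_distrib[symmetric] abs_divide)
    ultimately show ?case using elim by linarith
  qed
  then show "\<exists>a. \<forall>\<^sub>F n in sequentially. \<bar>expectation (betti (window n)) / (2 * real n) ^ d - a\<bar> < e"
    by blast
qed

section \<open>Almost sure convergence along squares\<close>

lemma AE_block_sum_squares:
  "AE \<omega> in M. (\<lambda>j. (block_sum k (j\<^sup>2) \<omega> - expectation (block_sum k (j\<^sup>2))) / (2 * real (j\<^sup>2)) ^ d) \<longlonglongrightarrow> 0"
proof (rule AE_tendsto_0_if_summable_integral_square)
  define C where "C = (4 * (2 * real k + 1) ^ d)\<^sup>2"
  let ?G = "\<lambda>j::nat. grid (j\<^sup>2 div period k)"
  let ?V = "\<lambda>j \<omega>. (\<Sum>z\<in>?G j. betti (block k z) \<omega> - block_mean k)"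
  have eq: "block_sum k (j\<^sup>2) \<omega> - expectation (block_sum k (j\<^sup>2)) = ?V j \<omega>" for j \<omega>
    unfolding expectation_block_sum block_sum_def by (simp add: sum_subtractf card_grid)
  note var = variance_blocks[OF finite_grid grid_extensional, where k = k, folded block_mean_def C_def]
  show "integrable M (\<lambda>\<omega>. ((block_sum k (j\<^sup>2) \<omega> - expectation (block_sum k (j\<^sup>2))) / (2 * real (j\<^sup>2)) ^ d)\<^sup>2)" for j
    unfolding eq power_divide using var(1) by simp
  have C0: "0 \<le> C" by (simp add: C_def)
  have bound: "expectation (\<lambda>\<omega>. (?V j \<omega> / (2 * real (j\<^sup>2)) ^ d)\<^sup>2) \<le> C * inverse (real j ^ 2)" for j
  proof (cases "j = 0")
    \<comment> \<open>At \<open>j = 0\<close> both sides are 0: positivity of \<open>d\<close> makes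
      the volume 0, and division by 0 yields 0.\<close>
    case True
    then show ?thesis using d_pos by (simp add: zero_power)
  next
    case False
    then have j: "1 \<le> real j" by simp
    define N where "N = (2 * real (j\<^sup>2)) ^ d"
    have "1 \<le> 2 * real (j\<^sup>2)" using j by (simp add: one_le_power order_trans[of 1 "real j ^ 2"])
    then have "2 * real (j\<^sup>2) \<le> N"
      unfolding N_def using d_pos by (intro self_le_power) auto
    then have N: "real j ^ 2 \<le> N" by (simp add: order_trans[of "real j ^ 2" "2 * real j ^ 2"])
    have j2: "0 < real j ^ 2" using j by simp
    then have N0: "0 < N" using N by linarith
    \<comment> \<open>There are at most as many blocks as units of volume, so the variance is at
      most \<open>N * C\<close>, and the density has variance at most \<open>C / N\<close>.\<close>
    have "real (card (?G j)) \<le> N"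
      unfolding card_grid N_def by (simp add: power_mono)
    then have "expectation (\<lambda>\<omega>. (?V j \<omega>)\<^sup>2) \<le> N * C"
      using var(2)[of "j\<^sup>2 div period k"] C0 by (meson mult_right_mono order_trans)
    then have "expectation (\<lambda>\<omega>. (?V j \<omega>)\<^sup>2) / N\<^sup>2 \<le> N * C / N\<^sup>2"
      by (intro divide_right_mono) auto
    also have "\<dots> = C * inverse N"
      using N0 by (simp add: power2_eq_square field_simps)
    also have "\<dots> \<le> C * inverse (real j ^ 2)"
      using C0 N j2 by (intro mult_left_mono le_imp_inverse_le)
    finally show ?thesis
      unfolding N_def[symmetric] power_divide by simp
  qed
  have "summable (\<lambda>j. C * inverse (real j ^ 2))"
    by (intro summable_mult inverse_power_summable) simp
  then have "summable (\<lambda>j. expectation (\<lambda>\<omega>. (?V j \<omega> / (2 * real (j\<^sup>2)) ^ d)\<^sup>2))"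
    by (rule summable_comparison_test'[where N = 0]) (use bound in simp)
  then show "summable (\<lambda>j. expectation (\<lambda>\<omega>. ((block_sum k (j\<^sup>2) \<omega> - expectation (block_sum k (j\<^sup>2)))
      / (2 * real (j\<^sup>2)) ^ d)\<^sup>2))"
    unfolding eq .
qed

lemma AE_window_squares:
  "AE \<omega> in M. (\<lambda>j. betti (window (j\<^sup>2)) \<omega> / (2 * real (j\<^sup>2)) ^ d
    - expectation (betti (window (j\<^sup>2))) / (2 * real (j\<^sup>2)) ^ d) \<longlonglongrightarrow> 0"
proof -
  \<comment> \<open>Block sizes are countable, so one null set serves all of them and
    \<open>k\<close> may be chosen afterwards, depending on \<open>e\<close>.\<close>
  have "AE \<omega> in M. \<forall>k. (\<lambda>j. (block_sum k (j\<^sup>2) \<omega> - expectation (block_sum k (j\<^sup>2))) / (2 * real (j\<^sup>2)) ^ d) \<longlonglongrightarrow> 0"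
    unfolding AE_all_countable using AE_block_sum_squares by blast
  then show ?thesis
  proof eventually_elim
    case (elim \<omega>)
    show ?case
    proof (rule tendstoI)
      fix e :: real assume e: "0 < e"
      \<comment> \<open>The three thirds pay for replacing the window by its blocks pathwise, for
        doing so in expectation, and for the fluctuation of the block sum.\<close>
      obtain k where "\<forall>\<^sub>F n in sequentially. block_error k n < e / 3"
        using block_error_small[of "e / 3"] e by auto
      moreover have "filterlim (\<lambda>j::nat. j\<^sup>2) sequentially sequentially" by real_asymp
      ultimately have "\<forall>\<^sub>F j in sequentially. block_error k (j\<^sup>2) < e / 3"
        by (rule eventually_compose_filterlim)
      moreover have "\<forall>\<^sub>F j in sequentially.
          \<bar>(block_sum k (j\<^sup>2) \<omega> - expectation (block_sum k (j\<^sup>2))) / (2 * real (j\<^sup>2)) ^ d\<bar> < e / 3"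
        using tendstoD[OF elim[rule_format, of k], of "e / 3"] e unfolding dist_real_def by simp
      ultimately show "\<forall>\<^sub>F j in sequentially. dist (betti (window (j\<^sup>2)) \<omega> / (2 * real (j\<^sup>2)) ^ d
          - expectation (betti (window (j\<^sup>2))) / (2 * real (j\<^sup>2)) ^ d) 0 < e"
      proof eventually_elim
        case (elim j)
        define N where "N = (2 * real (j\<^sup>2)) ^ d"
        have N: "\<bar>x\<bar> / N = \<bar>x / N\<bar>" for x by (simp add: N_def)
        have "\<bar>betti (window (j\<^sup>2)) \<omega> / N - block_sum k (j\<^sup>2) \<omega> / N\<bar> \<le> block_error k (j\<^sup>2)"
          using window_block_sum_diff[of "j\<^sup>2" \<omega> k] unfolding N_def[symmetric] N diff_divide_distrib .
        moreover have "\<bar>expectation (betti (window (j\<^sup>2))) / N - expectation (block_sum k (j\<^sup>2)) / N\<bar> \<le> block_error k (j\<^sup>2)"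
          using expectation_window_diff[of "j\<^sup>2" k] unfolding N_def[symmetric] N diff_divide_distrib .
        ultimately show ?case
          using elim unfolding N_def[symmetric] diff_divide_distrib dist_real_def by linarith
      qed
    qed
  qed
qed

section \<open>From squares to all window sizes\<close>

lemma tendsto_window_if_squares:
  assumes "(\<lambda>j. betti (window (j\<^sup>2)) \<omega> / (2 * real (j\<^sup>2)) ^ d) \<longlonglongrightarrow> c"
  shows "(\<lambda>n. betti (window n) \<omega> / (2 * real n) ^ d) \<longlonglongrightarrow> c"
proof -
  \<comment> \<open>The largest square not above \<open>n\<close> is \<open>(r n)\<^sup>2\<close>.
    Its ratio to \<open>n\<close> tends to 1, so the layer between the two windows has vanishing
    relative volume.\<close>
  define r where "r = (\<lambda>n::nat. nat \<lfloor>sqrt (real n)\<rfloor>)"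
  have r_le: "(r n)\<^sup>2 \<le> n" for n
  proof -
    have "real (r n) \<le> sqrt (real n)" by (simp add: r_def)
    then have "(real (r n))\<^sup>2 \<le> (sqrt (real n))\<^sup>2" by (intro power_mono) auto
    then have "real ((r n)\<^sup>2) \<le> real n" by simp
    then show ?thesis by (simp only: of_nat_le_iff)
  qed
  have "filterlim r sequentially sequentially"
    unfolding r_def by real_asymp
  then have "(\<lambda>n. betti (window ((r n)\<^sup>2)) \<omega> / (2 * real ((r n)\<^sup>2)) ^ d) \<longlonglongrightarrow> c"
    by (rule filterlim_compose[OF assms])
  moreover have "(\<lambda>n. real (r n) ^ 2 / real n) \<longlonglongrightarrow> 1"
    unfolding r_def by real_asymp
  ultimately have main: "(\<lambda>n. betti (window ((r n)\<^sup>2)) \<omega> / (2 * real ((r n)\<^sup>2)) ^ d * (real (r n) ^ 2 / real n) ^ d)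
      \<longlonglongrightarrow> c * 1 ^ d"
    by (intro tendsto_intros)
  have err: "(\<lambda>n. (betti (window n) \<omega> - betti (window ((r n)\<^sup>2)) \<omega>) / (2 * real n) ^ d) \<longlonglongrightarrow> 0"
  proof (rule Lim_null_comparison)
    have "(\<lambda>n. (4 * real n + 1) / (2 * real n)) \<longlonglongrightarrow> 2"
      "(\<lambda>n. (4 * real (r n) ^ 2 + 1) / (2 * real n)) \<longlonglongrightarrow> 2"
      unfolding r_def by real_asymp+
    then have "(\<lambda>n. 2 * (((4 * real n + 1) / (2 * real n)) ^ d - ((4 * real (r n) ^ 2 + 1) / (2 * real n)) ^ d))
      \<longlonglongrightarrow> 2 * (2 ^ d - 2 ^ d)"
      by (intro tendsto_intros)
    then show "(\<lambda>n. 2 * (((4 * real n + 1) / (2 * real n)) ^ d - ((4 * real (r n) ^ 2 + 1) / (2 * real n)) ^ d))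
      \<longlonglongrightarrow> 0" by simp
    show "\<forall>\<^sub>F n in sequentially. norm ((betti (window n) \<omega> - betti (window ((r n)\<^sup>2)) \<omega>) / (2 * real n) ^ d)
      \<le> 2 * (((4 * real n + 1) / (2 * real n)) ^ d - ((4 * real (r n) ^ 2 + 1) / (2 * real n)) ^ d)"
    proof (intro always_eventually allI)
      fix n
      have "\<bar>betti (window n) \<omega> - betti (window ((r n)\<^sup>2)) \<omega>\<bar> / (2 * real n) ^ d
          \<le> 2 * ((4 * real n + 1) ^ d - (4 * real (r n) ^ 2 + 1) ^ d) / (2 * real n) ^ d"
        using betti_window_mono[OF r_le[of n], of \<omega>] by (intro divide_right_mono) auto
      then show "norm ((betti (window n) \<omega> - betti (window ((r n)\<^sup>2)) \<omega>) / (2 * real n) ^ d)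
        \<le> 2 * (((4 * real n + 1) / (2 * real n)) ^ d - ((4 * real (r n) ^ 2 + 1) / (2 * real n)) ^ d)"
        unfolding power_divide diff_divide_distrib[symmetric] by (simp add: abs_divide)
    qed
  qed
  have "(\<lambda>n. betti (window ((r n)\<^sup>2)) \<omega> / (2 * real ((r n)\<^sup>2)) ^ d * (real (r n) ^ 2 / real n) ^ d
      + (betti (window n) \<omega> - betti (window ((r n)\<^sup>2)) \<omega>) / (2 * real n) ^ d) \<longlonglongrightarrow> c * 1 ^ d + 0"
    by (intro tendsto_add main err)
  \<comment> \<open>For \<open>0 < n\<close> also \<open>0 < r n\<close>, so the volume of the
    smaller window cancels and the normalisation becomes that of size \<open>n\<close>.\<close>
  moreover have "\<forall>\<^sub>F n in sequentially.
      betti (window ((r n)\<^sup>2)) \<omega> / (2 * real ((r n)\<^sup>2)) ^ d * (real (r n) ^ 2 / real n) ^ d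
      + (betti (window n) \<omega> - betti (window ((r n)\<^sup>2)) \<omega>) / (2 * real n) ^ d
      = betti (window n) \<omega> / (2 * real n) ^ d"
    using eventually_gt_at_top[of 0]
  proof eventually_elim
    case (elim n)
    then have "0 < r n" by (simp add: r_def)
    then have "betti (window ((r n)\<^sup>2)) \<omega> / (2 * real ((r n)\<^sup>2)) ^ d * (real (r n) ^ 2 / real n) ^ d
        = betti (window ((r n)\<^sup>2)) \<omega> / (2 * real n) ^ d"
      using elim by (simp add: power_mult_distrib power_divide field_simps)
    then show ?case by (simp add: diff_divide_distrib)
  qed
  ultimately show ?thesis
    using Lim_transform_eventually by fastforce
qed

lemma betti_density:
  "\<exists>c\<ge>0. (\<lambda>n. expectation (betti (window n)) / (2 * real n) ^ d) \<longlonglongrightarrow> c \<and>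
    (AE \<omega> in M. (\<lambda>n. betti (window n) \<omega> / (2 * real n) ^ d) \<longlonglongrightarrow> c)"
proof -
  obtain c where c: "(\<lambda>n. expectation (betti (window n)) / (2 * real n) ^ d) \<longlonglongrightarrow> c"
    using convergent_expectation by (auto simp: convergent_def)
  have "0 \<le> c"
    by (rule LIMSEQ_le_const[OF c])
      (auto simp: betti_def betti_births_nonneg intro!: exI[of _ 0] divide_nonneg_nonneg integral_nonneg)
  have "filterlim (\<lambda>j::nat. j\<^sup>2) sequentially sequentially" by real_asymp
  then have csq: "(\<lambda>j. expectation (betti (window (j\<^sup>2))) / (2 * real (j\<^sup>2)) ^ d) \<longlonglongrightarrow> c"
    by (rule filterlim_compose[OF c])
  have "AE \<omega> in M. (\<lambda>n. betti (window n) \<omega> / (2 * real n) ^ d) \<longlonglongrightarrow> c"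
    using AE_window_squares
  proof eventually_elim
    case (elim \<omega>)
    show ?case
      using tendsto_add[OF elim csq] by (intro tendsto_window_if_squares) simp
  qed
  with c \<open>0 \<le> c\<close> show ?thesis by blast
qed

end

theorem mainTheorem1:
  fixes d :: nat and M :: "'w measure" and X :: "'w \<Rightarrow> real \<Rightarrow> point set"
    and R :: nat and q :: nat and s t :: real
  assumes "prob_space M"
    and "random_cubical_filtration d M X"
    and "stationary d M X"
    and "R_dependent d M (real R) X"
    and "q < d"
    and "0 \<le> s" and "s \<le> t"
  shows "\<exists>c::real. 0 \<le> c \<and>
    (\<lambda>n. (\<integral>\<omega>. real (pers_betti d q (X \<omega> s \<inter> Lam d n) (X \<omega> t \<inter> Lam d n)) \<partial>M)
           / (2 * real n) ^ d) \<longlonglongrightarrow> c \<and>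
    (AE \<omega> in M. (\<lambda>n. real (pers_betti d q (X \<omega> s \<inter> Lam d n) (X \<omega> t \<inter> Lam d n))
           / (2 * real n) ^ d) \<longlonglongrightarrow> c)"
proof -
  interpret prob_space M by fact
  interpret stationary_dependent_filtration M d X R q s t
    using assms by unfold_locales auto
  \<comment> \<open>The sample paths are known to be filtrations only on \<open>space M\<close>,
    which is enough for the integral and for an almost sure statement.\<close>
  have eq: "real (pers_betti d q (X \<omega> s \<inter> Lam d n) (X \<omega> t \<inter> Lam d n)) = betti (window n) \<omega>"
    if "\<omega> \<in> space M" for \<omega> n
    using assms that pers_betti_eq_betti_births[of d "X \<omega>" s t q n]
    by (simp add: betti_def random_cubical_filtration_def)
  have "(\<integral>\<omega>. real (pers_betti d q (X \<omega> s \<inter> Lam d n) (X \<omega> t \<inter> Lam d n)) \<partial>M)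
      = expectation (betti (window n))" for n
    using eq by (intro Bochner_Integration.integral_cong) auto
  moreover obtain c where c: "0 \<le> c"
    "(\<lambda>n. expectation (betti (window n)) / (2 * real n) ^ d) \<longlonglongrightarrow> c"
    "AE \<omega> in M. (\<lambda>n. betti (window n) \<omega> / (2 * real n) ^ d) \<longlonglongrightarrow> c"
    using betti_density by blast
  moreover have "AE \<omega> in M. (\<lambda>n. real (pers_betti d q (X \<omega> s \<inter> Lam d n) (X \<omega> t \<inter> Lam d n))
      / (2 * real n) ^ d) \<longlonglongrightarrow> c"
    using c(3) AE_space by eventually_elim (simp add: eq)
  ultimately show ?thesis by auto
qed

end
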